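(* We have both $S_n = \Theta(5^{n/4})$ and $R_n = \Theta(5^{n/4})$ as $n \to \infty$.
   Context: All trees are finite, and a subtree of a tree is a nonempty connected subgraph (so a single vertex is a subtree, and the tree itself is a subtree). For a tree $T$, $|T|$ denotes its number of vertices (its order), and $\operatorname{ns}(T)$ denotes the number of nonisomorphic subtrees of $T$, i.e. the number of isomorphism classes (as unrooted trees) of subtrees of $T$. For a rooted tree $T$, $\operatorname{nr}(T)$ denotes the number of nonisomorphic subtrees of $T$ that contain the root, where two subtrees containing the root are considered isomorphic if there is a graph isomorphism between them that maps the root to itself. For $n \ge 1$, define $S_n = \max_{|T|=n} \operatorname{ns}(T)$, the maximum over all trees $T$ with $n$ vertices, and $R_n = \max_{|T|=n} \operatorname{nr}(T)$, the maximum over all rooted trees $T$ with $n$ vertices. *)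

theory Defs
  imports
    "HOL-Library.Landau_Symbols"
    "Graph_Theory.Pair_Digraph"
    "Graph_Theory.Digraph_Component"
    "Graph_Theory.Digraph_Isomorphism"
begin

text \<open>
  A finite simple undirected graph is represented by a \<^locale>\<open>pair_graph\<close>: a finite,
  loop-free, symmetric digraph without parallel arcs, in which an undirected edge $uv$ is the pair of arcs
  $(u,v)$, $(v,u)$. The library predicate \<^const>\<open>Digraph_Component.tree\<close> does not describe undirected
  trees in this representation, because a single edge already gives the directed cycle $u,v,u$ of
  length two. The undirected cycles are exactly the directed cycles of length at least three.
  The library predicate \<^const>\<open>Digraph_Component.connected\<close> includes nonemptiness.
\<close>

definition undirected_tree :: "'a pair_pre_digraph \<Rightarrow> bool" where
  "undirected_tree T \<longleftrightarrow>
     pair_graph T \<and> Digraph_Component.connected (with_proj T) \<and>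
     \<not> (\<exists>p. pre_digraph.cycle (with_proj T) p \<and> 3 \<le> length p)"

text \<open>
  In the library a subgraph need not inherit symmetry, so \<^term>\<open>pair_graph H\<close> is needed
  for \<^term>\<open>H\<close> to be an undirected subgraph.
\<close>

definition subtrees :: "'a pair_pre_digraph \<Rightarrow> 'a pair_pre_digraph set" where
  "subtrees T =
     {H. pair_graph H \<and> subgraph (with_proj H) (with_proj T) \<and>
         Digraph_Component.connected (with_proj H)}"

definition rooted_subtrees :: "'a pair_pre_digraph \<Rightarrow> 'a \<Rightarrow> 'a pair_pre_digraph set" where
  "rooted_subtrees T r = {H \<in> subtrees T. r \<in> pverts H}"

text \<open>The following is \<^const>\<open>digraph_iso\<close> with the extra condition that the roots correspond.\<close>

definition rooted_iso :: "'a pair_pre_digraph \<Rightarrow> 'a \<Rightarrow> 'b pair_pre_digraph \<Rightarrow> 'b \<Rightarrow> bool" where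
  "rooted_iso G r H s \<longleftrightarrow>
     (\<exists>f. pre_digraph.digraph_isomorphism (with_proj G) f \<and> with_proj H = app_iso f (with_proj G) \<and>
          iso_verts f r = s)"

definition ns :: "'a pair_pre_digraph \<Rightarrow> nat" where
  "ns T = card (subtrees T //
     {(H, K). H \<in> subtrees T \<and> K \<in> subtrees T \<and> digraph_iso (with_proj H) (with_proj K)})"

definition nr :: "'a pair_pre_digraph \<Rightarrow> 'a \<Rightarrow> nat" where
  "nr T r = card (rooted_subtrees T r //
     {(H, K). H \<in> rooted_subtrees T r \<and> K \<in> rooted_subtrees T r \<and> rooted_iso H r K r})"

text \<open>
  Every finite tree is isomorphic to one whose vertices are natural numbers, so the maxima
  can be taken over trees with vertices in \<^typ>\<open>nat\<close>. There are only finitely many isomorphism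
  types of trees with \<^term>\<open>n\<close> vertices, so the sets of values are finite, and they are
  nonempty for \<^term>\<open>n \<ge> 1\<close>.
\<close>

definition S_max :: "nat \<Rightarrow> nat" where
  "S_max n = Max {ns T | T :: nat pair_pre_digraph. undirected_tree T \<and> card (pverts T) = n}"

definition R_max :: "nat \<Rightarrow> nat" where
  "R_max n = Max {nr T r | (T :: nat pair_pre_digraph) r.
     undirected_tree T \<and> r \<in> pverts T \<and> card (pverts T) = n}"

end

theory Submission
  imports Defs "HOL-Library.FuncSet" "HOL-Library.Multiset" "HOL-Library.Set_Algebras"
begin

text \<open>
  Write $\rho = 5^{1/4}$. Everything rests on the inequality $N(T) \le \rho^{|T|}$, where $N(T)$ is the
  number of shapes (root-preserving isomorphism types) of subtrees of the rooted tree $T$ that contain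
  its root.

  \<^bold>\<open>The rooted upper bound.\<close> Up to isomorphism a rooted tree is the multiset of its branches, and a
  subtree containing the root arises by taking from every branch $B_i$ either nothing or a subtree
  containing the root of $B_i$. So $N(T)$ is the cardinality of the Minkowski sum, in the monoid of
  multisets, of the option sets of the branches. The naive estimate $\prod_i (1 + N(B_i))$ forgets that
  equal choices in different branches give the same multiset and is too weak: already for a star it is
  exponential with the wrong base. It is enough to exploit that all branches with at least two
  vertices have the three options ``nothing'', ``one vertex'' and ``two adjacent vertices'' in common.
  If the root has $l$ one-vertex branches and the other branches have $w_i + 1$ shapes, this yields
  \[ N(T) \le (l+1) e_d + (l+2) e_{d-1} + e_{d-2} \]
  with elementary symmetric polynomials $e_j$ in $w_1, \dots, w_d$ (\<open>card_forests_le\<close>).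

  By induction $w_i \le \rho^{n_i} - 1$ for a branch with $n_i$ vertices, and integrality improves this
  for $n_i \le 7$. It remains to bound the right-hand side by $\rho^{1 + l + \sum n_i}$. Equality occurs
  for the tree with branches of one and two vertices (called \<open>spider\<close> here: 4 vertices, 5 shapes),
  which makes the estimate delicate. There are three cases.

  \<^item> Two branches are spiders. Their two option sets coincide and have 6 elements, so together they
  contribute at most $\binom{7}{2} = 21 \le \rho^8$, and the remaining tree is smaller.

  \<^item> Some branch has two vertices, or three vertices while $l \ge 1$. Then adding any further branch
  with $n_i$ vertices multiplies the bound by at most $w_i + 1 \le \rho^{n_i}$
  (\<open>config_bound_append_base\<close>), and the small base configuration is checked directly.

  \<^item> Otherwise put $s = \sum_i 1/w_i$. The bound is at most
  $\prod_i w_i \cdot (l + 1 + (l+2) s + s^2/2)$. The quadratic is absorbed into $C e^{r s}$ and the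
  exponential is distributed over the product, as $w_i e^{r/w_i} \le \rho^{n_i}$ for the branches that
  are still possible, with the exception of at most one spider, which is kept separate.

  The induction needs a little more than $N(T) \le \rho^{|T|}$, namely a gap of $1/4$ once $|T| \ge 8$;
  this is the predicate \<open>within_bound\<close>.

  \<^bold>\<open>The unrooted upper bound.\<close> Root $T$ anywhere. Every subtree has a unique vertex $v$ closest to
  the root, and it is a root-containing subtree of the part $T_v$ below $v$. So the number of
  isomorphism types is at most $\sum_v \rho^{|T_v|}$, which is $O(\rho^{|T|})$ because
  $|T_v| < |T|$ for $v$ below the root and $x \mapsto \rho^x - 1$ is superadditive (\<open>card_allsub_le\<close>).

  \<^bold>\<open>Passing from graphs to branch multisets.\<close> In an undirected tree with a chosen root every arc
  joins a vertex to its parent, and a subtree inherits the parent function. Reading off the branches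
  recursively gives a code, and two subtrees with equal codes are isomorphic
  (\<open>same_code_vertex_iso\<close>).

  \<^bold>\<open>The lower bound.\<close> Take a long path (the spine) from a root, attach to $k$ consecutive spine
  vertices a leaf and a path of two vertices each, and attach at least five leaves to the root. A
  subtree containing the spine and all the leaves at the root can be chosen in 5 nonequivalent ways at
  each of the $k$ places, and the degree of the root together with the length of the spine forces
  every isomorphism between two such subtrees to fix the spine. This gives $5^k$ types
  with $n = 4 k + O(1)$ vertices.
\<close>

section \<open>Rooted trees as multisets of branches\<close>

text \<open>
  Rooted trees up to isomorphism: branches are unordered, and equality of terms is isomorphism.
\<close>

datatype rtree = Node "rtree multiset"

primrec rsize :: "rtree \<Rightarrow> nat" where
  "rsize (Node M) = Suc (\<Sum>\<^sub># (image_mset rsize M))"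

text \<open>
  What a branch can contribute to the multiset of branches of a subtree: nothing, or one of the
  shapes in \<^term>\<open>A\<close>.
\<close>
definition choices :: "'a set \<Rightarrow> 'a multiset set" where
  "choices A = insert {#} ((\<lambda>s. {#s#}) ` A)"

text \<open>
  The shapes of the subtrees containing the root. The sum is the Minkowski sum of sets of multisets.
\<close>
primrec rsub :: "rtree \<Rightarrow> rtree set" where
  "rsub (Node M) = Node ` (\<Sum>\<^sub># (image_mset choices (image_mset rsub M)))"

abbreviation forests :: "rtree multiset \<Rightarrow> rtree multiset set" where
  "forests M \<equiv> (\<Sum>t\<in>#M. choices (rsub t))"

abbreviation "leaf \<equiv> Node {#}"
abbreviation "twig \<equiv> Node {#leaf#}"

lemma rsub_Node: "rsub (Node M) = Node ` forests M"
  by (simp add: multiset.map_comp comp_def)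

declare rsub.simps [simp del]

lemma finite_choices [simp]: "finite (choices A) \<longleftrightarrow> finite A"
  by (auto simp: choices_def finite_image_iff inj_on_def)

lemma card_choices: "finite A \<Longrightarrow> card (choices A) = Suc (card A)"
  unfolding choices_def by (subst card_insert_disjoint) (auto simp: card_image inj_on_def)

lemma finite_forests: "(\<And>t. t \<in># M \<Longrightarrow> finite (rsub t)) \<Longrightarrow> finite (forests M)"
  by (induction M) (auto intro!: finite_set_plus)

lemma finite_rsub [simp]: "finite (rsub t)"
  by (induction t) (auto simp: rsub_Node intro!: finite_forests)

lemma finite_forests_rsub [simp]: "finite (forests M)"
  by (rule finite_forests) simp

lemma card_rsub: "card (rsub (Node M)) = card (forests M)"
  by (simp add: rsub_Node card_image inj_on_def)

lemma empty_in_forests [simp]: "{#} \<in> forests M"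
proof (induction M)
  case (add t M)
  have "{#} + {#} \<in> choices (rsub t) + forests M"
    using add by (intro set_plus_intro) (auto simp: choices_def)
  then show ?case by simp
qed auto

lemma leaf_in_rsub [simp]: "leaf \<in> rsub t"
  by (cases t) (auto simp: rsub_Node)

lemma twig_in_rsub: "2 \<le> rsize t \<Longrightarrow> twig \<in> rsub t"
proof (cases t)
  case (Node M)
  assume "2 \<le> rsize t"
  then have "M \<noteq> {#}" by (auto simp: Node)
  then obtain s K where M: "M = add_mset s K" by (metis multiset_cases)
  have "{#leaf#} + {#} \<in> choices (rsub s) + forests K"
    by (intro set_plus_intro empty_in_forests) (auto simp: choices_def)
  then show ?thesis by (auto simp: Node M rsub_Node)
qed

lemma card_set_plus_le:
  fixes A B :: "'a :: comm_monoid_add set"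
  assumes "finite A" "finite B"
  shows "card (A + B) \<le> card A * card B"
proof -
  have "A + B = (\<lambda>(a,b). a + b) ` (A \<times> B)" by (auto simp: set_plus_def)
  then show ?thesis using card_image_le[of "A \<times> B" "\<lambda>(a,b). a + b"] assms
    by (simp add: card_cartesian_product)
qed

text \<open>
  Unordered pairs: a sumset \<^term>\<open>A + A\<close> in a commutative monoid has at most $\binom{|A|+1}{2}$ elements.
  This is how two equal branches are counted.
\<close>
lemma card_set_plus_self_le:
  fixes A :: "'a :: comm_monoid_add set"
  assumes "finite A"
  shows "2 * card (A + A) \<le> card A * (card A + 1)"
  using assms
proof (induction A)
  case (insert a A)
  have "insert a A + insert a A = (A + A) \<union> ((+) a) ` (insert a A)"
    by (auto simp: insert_set_plus set_plus_insert)
  then have "card (insert a A + insert a A) \<le> card (A + A) + card (insert a A)"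
    using card_Un_le[of "A + A"] card_image_le[of "insert a A" "(+) a"] insert
    by (smt (verit) add_left_mono finite_insert le_trans)
  then show ?case using insert by simp
qed (auto simp: set_plus_def)

text \<open>
  Think of \<^term>\<open>u\<close> as the one-vertex and of \<^term>\<open>v\<close> as the two-vertex branch of a subtree: these are the
  multisets obtainable from \<^term>\<open>l\<close> branches with options nothing and \<^term>\<open>u\<close>, and \<^term>\<open>k\<close> branches with
  options nothing, \<^term>\<open>u\<close> and \<^term>\<open>v\<close>.
\<close>
definition common_configs :: "'a multiset \<Rightarrow> 'a multiset \<Rightarrow> nat \<Rightarrow> nat \<Rightarrow> 'a multiset set" where
  "common_configs u v l k = {repeat_mset a u + repeat_mset b v | a b. b \<le> k \<and> a + b \<le> k + l}"

lemma common_configs_alt: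
  "common_configs u v l k = (\<lambda>(b,a). repeat_mset a u + repeat_mset b v) ` (SIGMA b:{..k}. {..k + l - b})"
  (is "_ = ?f ` ?S")
proof (intro equalityI subsetI)
  fix m assume "m \<in> common_configs u v l k"
  then obtain a b where "b \<le> k" "a + b \<le> k + l" "m = repeat_mset a u + repeat_mset b v"
    by (auto simp: common_configs_def)
  then show "m \<in> ?f ` ?S" by (intro image_eqI[of _ _ "(b,a)"]) auto
qed (force simp: common_configs_def)

lemma finite_common_configs [simp]: "finite (common_configs u v l k)"
  unfolding common_configs_alt by auto

text \<open>
  This is $\sum_{b \le k} (k + l - b + 1)$: once \<^term>\<open>b\<close> copies of \<^term>\<open>v\<close> are used, at most $k + l - b$
  branches are left to contribute a copy of \<^term>\<open>u\<close>.
\<close>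
lemma card_common_configs: "2 * card (common_configs u v l k) \<le> (k + 1) * (2 * l + 2 + k)"
proof -
  have "2 * (\<Sum>b\<le>j. Suc (k + l - b)) = (j + 1) * (2 * (k + l) + 2 - j)" if "j \<le> k" for j
    using that
  proof (induction j)
    case (Suc j)
    then obtain d where "k = Suc j + d" using le_Suc_ex by blast
    then show ?case using Suc by (simp add: algebra_simps)
  qed auto
  from this[of k] have "2 * (\<Sum>b\<le>k. Suc (k + l - b)) = (k + 1) * (2 * l + 2 + k)"
    by simp
  moreover have "card (common_configs u v l k) \<le> (\<Sum>b\<le>k. Suc (k + l - b))"
    unfolding common_configs_alt by (rule card_image_le[THEN order_trans]) auto
  ultimately show ?thesis by linarith
qed

lemma common_configs_plus: "common_configs u v l k + {{#}, u, v} \<subseteq> common_configs u v l (Suc k)"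
proof
  fix m assume "m \<in> common_configs u v l k + {{#}, u, v}"
  then obtain a b w where "b \<le> k" "a + b \<le> k + l" and m: "m = repeat_mset a u + repeat_mset b v + w"
    and "w \<in> {{#}, u, v}"
    by (auto simp: common_configs_def set_plus_def)
  then consider "w = {#}" | "w = u" | "w = v" by auto
  then show "m \<in> common_configs u v l (Suc k)"
  proof cases
    case 1 then show ?thesis using \<open>b \<le> k\<close> \<open>a + b \<le> k + l\<close> m by (force simp: common_configs_def)
  next
    case 2
    then have "m = repeat_mset (Suc a) u + repeat_mset b v" by (simp add: m)
    then show ?thesis using \<open>b \<le> k\<close> \<open>a + b \<le> k + l\<close> unfolding common_configs_def
      by (intro CollectI exI[of _ "Suc a"] exI[of _ b]) auto
  next
    case 3
    then have "m = repeat_mset a u + repeat_mset (Suc b) v" by (simp add: m)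
    then show ?thesis using \<open>b \<le> k\<close> \<open>a + b \<le> k + l\<close> unfolding common_configs_def
      by (intro CollectI exI[of _ a] exI[of _ "Suc b"]) auto
  qed
qed

text \<open>
  The elementary symmetric polynomials of degree $d$, $d - 1$ and $d - 2$ of a list of length $d$: sums of
  products with no, one or two entries omitted.
\<close>
fun omit0 omit1 omit2 :: "real list \<Rightarrow> real" where
  "omit0 [] = 1" | "omit0 (w # ws) = w * omit0 ws"
| "omit1 [] = 0" | "omit1 (w # ws) = w * omit1 ws + omit0 ws"
| "omit2 [] = 0" | "omit2 (w # ws) = w * omit2 ws + omit1 ws"

definition config_bound :: "nat \<Rightarrow> real list \<Rightarrow> real" where
  "config_bound l ws = (real l + 1) * omit0 ws + (real l + 2) * omit1 ws + omit2 ws"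

text \<open>
  Each option set splits into the three common options and $w - 1$ others, where
  $w = |A| - 2$. Choosing a common option raises \<^term>\<open>k\<close> by one, choosing another one contributes a
  factor $w - 1$. So a bound $f(k)$ for the list \<^term>\<open>As\<close> leads to $(w - 1) f(k) + f(k + 1)$ for \<^term>\<open>A # As\<close>. The
  right-hand side is the solution of this recursion: as the value for the empty list is quadratic in
  \<^term>\<open>k\<close>, only its first two differences enter.
\<close>
lemma card_common_configs_plus_sum:
  assumes "\<And>A. A \<in> set As \<Longrightarrow> finite A \<and> {{#}, u, v} \<subseteq> A"
      and "u \<noteq> {#}" "v \<noteq> {#}" "u \<noteq> v"
  defines "ws \<equiv> map (\<lambda>A. real (card A) - 2) As"
  shows "real (card (common_configs u v l k + sum_list As))
     \<le> (real k + 1) * (2 * real l + 2 + real k) / 2 * omit0 ws + (real l + 2 + real k) * omit1 ws + omit2 ws"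
  using assms(1) unfolding ws_def
proof (induction As arbitrary: k)
  case Nil
  have "real (2 * card (common_configs u v l k)) \<le> real ((k + 1) * (2 * l + 2 + k))"
    using card_common_configs of_nat_le_iff by blast
  then show ?case by (simp add: algebra_simps)
next
  case (Cons A As)
  let ?D = "common_configs u v l" and ?S = "sum_list As" and ?X = "A - {{#}, u, v}"
  define ws where "ws = map (\<lambda>A. real (card A) - 2) As"
  have fin: "finite A" "finite ?S" and sub: "{{#}, u, v} \<subseteq> A"
  proof -
    have "finite A" if "A \<in> set As" for A using Cons.prems that by auto
    then show "finite ?S" by (induction As) (auto intro: finite_set_plus)
  qed (use Cons.prems in auto)
  have cX: "real (card ?X) = real (card A) - 3"
  proof -
    have "card {{#}, u, v} = 3" using assms(2-4) by auto
    moreover have "card {{#}, u, v} \<le> card A" using sub fin by (simp add: card_mono)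
    ultimately show ?thesis using sub fin by (simp add: card_Diff_subset)
  qed
  have "A = {{#}, u, v} \<union> ?X" using sub by blast
  then have "?D k + (A + ?S) = ?D k + ({{#}, u, v} \<union> ?X) + ?S"
    unfolding add.assoc by (rule arg_cong)
  also have "\<dots> = (?D k + {{#}, u, v} + ?S) \<union> (?X + (?D k + ?S))"
    unfolding set_plus_Un Un_set_plus by (simp add: add_ac)
  also have "\<dots> \<subseteq> (?D (Suc k) + ?S) \<union> (?X + (?D k + ?S))"
    using common_configs_plus[of u v l k] by (intro Un_mono set_plus_mono2) auto
  finally have "card (?D k + (A + ?S)) \<le> card ((?D (Suc k) + ?S) \<union> (?X + (?D k + ?S)))"
    using fin by (intro card_mono) (auto intro!: finite_set_plus)
  also have "\<dots> \<le> card (?D (Suc k) + ?S) + card ?X * card (?D k + ?S)"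
    using fin by (intro order.trans[OF card_Un_le] add_left_mono card_set_plus_le)
      (auto intro!: finite_set_plus)
  finally have "real (card (?D k + (A + ?S)))
     \<le> real (card (?D (Suc k) + ?S)) + real (card ?X) * real (card (?D k + ?S))"
    by (metis of_nat_add of_nat_le_iff of_nat_mult)
  also have "\<dots> \<le> ((real (Suc k) + 1) * (2 * real l + 2 + real (Suc k)) / 2 * omit0 ws
       + (real l + 2 + real (Suc k)) * omit1 ws + omit2 ws)
     + real (card ?X) * ((real k + 1) * (2 * real l + 2 + real k) / 2 * omit0 ws + (real l + 2 + real k) * omit1 ws + omit2 ws)"
    unfolding ws_def by (intro add_mono mult_left_mono Cons.IH) (use Cons.prems in auto)
  finally show ?case
    unfolding cX list.map ws_def[symmetric] by (simp add: field_simps)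
qed

lemma forests_leaves: "forests (replicate_mset l leaf) \<subseteq> common_configs {#leaf#} v l 0"
proof (induction l)
  case (Suc l)
  show ?case
  proof
    fix m assume "m \<in> forests (replicate_mset (Suc l) leaf)"
    then obtain w m' where m: "m = w + m'" "w \<in> choices (rsub leaf)" "m' \<in> forests (replicate_mset l leaf)"
      by (auto simp: set_plus_def)
    then have "m' \<in> common_configs {#leaf#} v l 0" using Suc by auto
    then obtain a where a: "a \<le> l" "m' = repeat_mset a {#leaf#}" by (auto simp: common_configs_def)
    have "w = {#} \<or> w = {#leaf#}" using m(2) by (auto simp: choices_def rsub_Node)
    then have "m = repeat_mset a {#leaf#} \<or> m = repeat_mset (Suc a) {#leaf#}"
      using a m(1) by auto
    then show "m \<in> common_configs {#leaf#} v (Suc l) 0"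
      using a(1) unfolding common_configs_def
      by (force intro: exI[of _ a] exI[of _ "Suc a"] exI[of _ "0::nat"])
  qed
qed (auto simp: common_configs_def)

text \<open>
  The bound on the number of shapes that is used throughout: branches with a single vertex are counted
  by \<^term>\<open>l\<close>, the others have the one-vertex and the two-vertex tree in common.
\<close>
lemma card_forests_le:
  assumes "\<And>t. t \<in> set ts \<Longrightarrow> 2 \<le> rsize t"
  shows "real (card (forests (replicate_mset l leaf + mset ts))) \<le> config_bound l (map (\<lambda>t. real (card (rsub t)) - 1) ts)"
proof -
  let ?As = "map (\<lambda>t. choices (rsub t)) ts"
  let ?D = "common_configs {#leaf#} {#twig#} l 0"
  have eq: "forests (mset ts) = sum_list ?As"
    by (induction ts) auto
  have fin: "finite (sum_list ?As)" unfolding eq[symmetric] by simp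
  have "real (card (?D + sum_list ?As)) \<le> (real 0 + 1) * (2 * real l + 2 + real 0) / 2 * omit0 (map (\<lambda>A. real (card A) - 2) ?As)
     + (real l + 2 + real 0) * omit1 (map (\<lambda>A. real (card A) - 2) ?As) + omit2 (map (\<lambda>A. real (card A) - 2) ?As)"
  proof (rule card_common_configs_plus_sum)
    fix A assume "A \<in> set ?As"
    then obtain t where "t \<in> set ts" "A = choices (rsub t)" by auto
    then show "finite A \<and> {{#}, {#leaf#}, {#twig#}} \<subseteq> A"
      using twig_in_rsub assms by (auto simp: choices_def)
  qed auto
  also have "map (\<lambda>A. real (card A) - 2) ?As = map (\<lambda>t. real (card (rsub t)) - 1) ts"
    by (auto simp: card_choices)
  finally have "real (card (?D + sum_list ?As)) \<le> config_bound l (map (\<lambda>t. real (card (rsub t)) - 1) ts)"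
    by (simp add: config_bound_def field_simps)
  moreover have "forests (replicate_mset l leaf + mset ts) \<subseteq> ?D + sum_list ?As"
    unfolding eq[symmetric] image_mset_union sum_mset.union
    by (intro set_plus_mono2 forests_leaves order_refl)
  then have "card (forests (replicate_mset l leaf + mset ts)) \<le> card (?D + sum_list ?As)"
    using fin by (intro card_mono finite_set_plus finite_common_configs)
  ultimately show ?thesis by linarith
qed

section \<open>The growth constant\<close>
definition rho :: real where "rho = 5 powr (1/4)"

lemma rho_pow4: "rho ^ 4 = 5"
  unfolding rho_def by (simp add: powr_power)

lemma rho_pos: "rho > 0"
  by (simp add: rho_def)

lemma rho_gt: "rho > 14953/10000"
proof (rule power_less_imp_less_base[of _ 4])
  show "(14953/10000) ^ 4 < rho ^ 4" unfolding rho_pow4 by (simp add: power_divide)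
qed (use rho_pos in simp)

lemma rho_ge_1: "1 \<le> rho"
  using rho_gt by simp

lemma rho_powers_gt:
  "rho > 14953/10000" "rho ^ 2 > 2236/1000" "rho ^ 3 > 33434/10000" "rho ^ 5 > 74765/10000" "rho ^ 6 > 111799/10000" "rho ^ 7 > 16717/1000"
proof -
  show *: "rho > 14953/10000" using rho_gt by simp
  have "rho ^ 2 > 2236/1000"
  proof (rule power_less_imp_less_base[of _ 2])
    show "(2236/1000) ^ 2 < (rho ^ 2) ^ 2"
      using rho_pow4 by (simp flip: power_mult add: power_divide)
  qed simp
  moreover have "rho ^ 3 > 33434/10000"
  proof -
    have "2236/1000 * (14953/10000) < rho ^ 2 * rho" using \<open>rho ^ 2 > 2236/1000\<close> *
      by (intro mult_strict_mono) auto
    then show ?thesis by (simp add: power3_eq_cube power2_eq_square)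
  qed
  ultimately show "rho ^ 2 > 2236/1000" "rho ^ 3 > 33434/10000" by auto
  have "rho ^ 5 = 5 * rho" "rho ^ 6 = 5 * rho ^ 2" "rho ^ 7 = 5 * rho ^ 3"
    using rho_pow4 by (simp_all add: eval_nat_numeral)
  then show "rho ^ 5 > 74765/10000" "rho ^ 6 > 111799/10000" "rho ^ 7 > 16717/1000"
    using * \<open>rho ^ 2 > 2236/1000\<close> \<open>rho ^ 3 > 33434/10000\<close> by auto
qed

lemma rho_powers_lt:
  "rho < 2" "rho ^ 2 < 3" "rho ^ 3 < 4" "rho ^ 5 < 8" "rho ^ 6 < 12" "rho ^ 7 < 17"
proof -
  have *: "rho < 1.4955"
  proof (rule power_less_imp_less_base[of _ 4])
    show "rho ^ 4 < 1.4955 ^ 4" unfolding rho_pow4 by (simp add: power_divide)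
  qed auto
  then have "rho ^ 2 < 1.4955 ^ 2" "rho ^ 3 < 1.4955 ^ 3"
    using rho_pos by (intro power_strict_mono; simp)+
  then have **: "rho ^ 2 < 2.3" "rho ^ 3 < 3.39" by (auto simp: power_divide)
  have "rho ^ 5 = 5 * rho" "rho ^ 6 = 5 * rho ^ 2" "rho ^ 7 = 5 * rho ^ 3"
    using rho_pow4 by (simp_all add: eval_nat_numeral)
  then show "rho < 2" "rho ^ 2 < 3" "rho ^ 3 < 4" "rho ^ 5 < 8" "rho ^ 6 < 12" "rho ^ 7 < 17"
    using * ** by auto
qed

lemma rho_pow_ge_25: "8 \<le> n \<Longrightarrow> rho ^ n \<ge> 25"
proof -
  assume "8 \<le> n"
  then have "rho ^ 8 \<le> rho ^ n" using rho_ge_1 by (intro power_increasing) auto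
  moreover have "rho ^ 8 = 25" using power_mult[of rho 4 2] rho_pow4 by simp
  ultimately show ?thesis by simp
qed

lemma rho_pow_mono: "m \<le> n \<Longrightarrow> rho ^ m \<le> rho ^ n"
  using rho_ge_1 by (intro power_increasing)

lemma rho_pow_pos [simp]: "rho ^ n > 0"
  using rho_pos by simp

section \<open>Two ways to estimate the symmetric polynomial bound\<close>
lemma config_bound_Cons: "config_bound l (w # ws) = w * config_bound l ws + (real l + 2) * omit0 ws + omit1 ws"
  by (simp add: config_bound_def algebra_simps)

lemma omit_nonneg:
  assumes "\<And>w. w \<in> set ws \<Longrightarrow> w \<ge> 0"
  shows "omit0 ws \<ge> 0" "omit1 ws \<ge> 0" "omit2 ws \<ge> 0"
proof -
  have "omit0 ws \<ge> 0 \<and> omit1 ws \<ge> 0 \<and> omit2 ws \<ge> 0" using assms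
    by (induction ws) auto
  then show "omit0 ws \<ge> 0" "omit1 ws \<ge> 0" "omit2 ws \<ge> 0" by auto
qed

text \<open>
  Once the list contains a small entry \<^term>\<open>b\<close>, one has $e_d \le (l+1) e_{d-1}$, and this persists when entries
  are added. By the recursion for the bound it implies that a new entry $w$ multiplies the bound by
  at most $w + 1$. If $b = 1$ and $l \ge 1$ there is even room for subtracting 1; this is needed where the
  base configuration attains the bound with equality.
\<close>
lemma config_bound_append_base:
  assumes "\<And>x. x \<in> set xs \<Longrightarrow> 1 \<le> w x \<and> w x + 1 \<le> rho ^ n x"
      and b: "1 \<le> b" "b \<le> real l + 1"
  shows "config_bound l (map w xs @ [b]) \<le> config_bound l [b] * rho ^ sum_list (map n xs)"
    and "1 \<le> l \<Longrightarrow> b = 1 \<Longrightarrow> xs \<noteq> [] \<Longrightarrow>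
           config_bound l (map w xs @ [b]) \<le> config_bound l [b] * rho ^ sum_list (map n xs) - 1"
proof -
  have inv: "omit0 (map w ys @ [b]) \<le> (real l + 1) * omit1 (map w ys @ [b]) \<and> 1 \<le> omit0 (map w ys @ [b]) \<and>
     (b = 1 \<longrightarrow> omit0 (map w ys @ [b]) \<le> omit1 (map w ys @ [b])) \<and> 0 \<le> omit2 (map w ys @ [b]) \<and>
     0 \<le> config_bound l (map w ys @ [b])" if "set ys \<subseteq> set xs" for ys
    using that
  proof (induction ys)
    case Nil
    then show ?case using b by (auto simp: config_bound_def)
  next
    case (Cons y ys)
    define zs where "zs = map w ys @ [b]"
    have y: "1 \<le> w y" using Cons.prems assms(1) by auto
    have IH: "omit0 zs \<le> (real l + 1) * omit1 zs" "1 \<le> omit0 zs" "b = 1 \<longrightarrow> omit0 zs \<le> omit1 zs" "0 \<le> omit2 zs" "0 \<le> config_bound l zs"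
      using Cons unfolding zs_def by auto
    have 1: "0 \<le> real l * omit0 zs" using IH by simp
    have 2: "0 \<le> omit1 zs" using IH by (smt (verit) mult_nonneg_nonpos of_nat_0_le_iff)
    have 3: "w y * omit0 zs \<le> w y * ((real l + 1) * omit1 zs)"
      using IH y by (intro mult_left_mono) auto
    have 4: "1 * 1 \<le> w y * omit0 zs" using y IH by (intro mult_mono) auto
    have 5: "b = 1 \<longrightarrow> w y * omit0 zs \<le> w y * omit1 zs" using y IH by (auto intro!: mult_left_mono)
    have 6: "0 \<le> w y * omit2 zs" "0 \<le> w y * config_bound l zs" "0 \<le> (real l + 2) * omit0 zs" using y IH by auto
    have 7: "(real l + 1) * (w y * omit1 zs + omit0 zs) = w y * ((real l + 1) * omit1 zs) + real l * omit0 zs + omit0 zs"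
      by (simp add: algebra_simps)
    have "w y * omit0 zs \<le> (real l + 1) * (w y * omit1 zs + omit0 zs)"
      unfolding 7 using 1 3 IH(2) by linarith
    then show ?case unfolding list.map append_Cons zs_def[symmetric] omit0.simps omit1.simps omit2.simps config_bound_Cons
      using 2 4 5 6 IH by linarith
  qed
  have step: "config_bound l (map w (y # ys) @ [b]) \<le> rho ^ n y * config_bound l (map w ys @ [b])
      - ((real l + 1) * omit1 (map w ys @ [b]) - omit0 (map w ys @ [b]))" if "set (y # ys) \<subseteq> set xs" for y ys
  proof -
    define zs where "zs = map w ys @ [b]"
    note I = inv[of ys, folded zs_def]
    have "(w y + 1) * config_bound l zs \<le> rho ^ n y * config_bound l zs"
      using assms(1)[of y] that I by (intro mult_right_mono) auto
    moreover have "0 \<le> omit2 zs" using I that by auto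
    ultimately show ?thesis
      unfolding list.map append_Cons zs_def[symmetric] config_bound_Cons by (simp add: config_bound_def algebra_simps)
  qed
  have main: "config_bound l (map w ys @ [b]) \<le> config_bound l [b] * rho ^ sum_list (map n ys)" if "set ys \<subseteq> set xs" for ys
    using that
  proof (induction ys)
    case (Cons y ys)
    have "config_bound l (map w (y # ys) @ [b]) \<le> rho ^ n y * config_bound l (map w ys @ [b])"
      using step[of y ys] inv[of ys] Cons.prems by auto
    also have "\<dots> \<le> rho ^ n y * (config_bound l [b] * rho ^ sum_list (map n ys))"
      using Cons by (intro mult_left_mono) (auto intro: less_imp_le)
    finally show ?case by (simp add: power_add mult_ac)
  qed simp
  then show "config_bound l (map w xs @ [b]) \<le> config_bound l [b] * rho ^ sum_list (map n xs)" by blast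
  assume *: "1 \<le> l" "b = 1" "xs \<noteq> []"
  then obtain y ys where xs: "xs = y # ys" by (cases xs) auto
  define zs where "zs = map w ys @ [b]"
  have I: "1 \<le> omit0 zs" "omit0 zs \<le> omit1 zs" using inv[of ys] * xs zs_def by auto
  have "1 * 1 \<le> real l * omit1 zs" using I * by (intro mult_mono) auto
  then have "(real l + 1) * omit1 zs - omit0 zs \<ge> 1" using I by (simp add: algebra_simps)
  then have "config_bound l (map w (y # ys) @ [b]) \<le> rho ^ n y * config_bound l (map w ys @ [b]) - 1"
    using step[of y ys] xs zs_def by auto
  also have "\<dots> \<le> rho ^ n y * (config_bound l [b] * rho ^ sum_list (map n ys)) - 1"
    using main[of ys] xs by (intro diff_right_mono mult_left_mono) (auto intro: less_imp_le)
  finally show "config_bound l (map w xs @ [b]) \<le> config_bound l [b] * rho ^ sum_list (map n xs) - 1"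
    by (simp add: xs power_add mult_ac)
qed

lemma exp_quadratic_le: "0 \<le> u \<Longrightarrow> 1 + u + u\<^sup>2 / 2 \<le> exp (u::real)"
  using exp_lower_Taylor_quadratic by simp

text \<open>
  With \<^term>\<open>s\<close> the sum of the reciprocals, $e_{d-1} = s\, e_d$ and $e_{d-2} \le \frac{s^2}{2} e_d$.
\<close>
lemma symmetric_sums:
  assumes "\<And>w. w \<in> set ws \<Longrightarrow> w > 0"
  defines "s \<equiv> sum_list (map (\<lambda>w. 1 / w) ws)"
  shows "omit0 ws > 0" "omit1 ws = omit0 ws * s" "omit2 ws \<le> omit0 ws * (s\<^sup>2 / 2)" "s \<ge> 0"
proof -
  have "omit0 ws > 0 \<and> omit1 ws = omit0 ws * s \<and> omit2 ws \<le> omit0 ws * (s\<^sup>2 / 2) \<and> s \<ge> 0"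
    using assms(1) unfolding s_def
  proof (induction ws)
    case (Cons w ws)
    define s where "s = sum_list (map (\<lambda>w. 1 / w) ws)"
    have w: "w > 0" using Cons.prems by auto
    have IH: "omit0 ws > 0" "omit1 ws = omit0 ws * s" "omit2 ws \<le> omit0 ws * (s\<^sup>2 / 2)" "s \<ge> 0"
      using Cons unfolding s_def by auto
    have "w * omit2 ws + omit1 ws \<le> w * (omit0 ws * (s\<^sup>2 / 2)) + omit0 ws * s"
      using IH w by (intro add_mono mult_left_mono) auto
    also have "\<dots> \<le> w * omit0 ws * ((1 / w + s)\<^sup>2 / 2)"
      using w IH by (simp add: field_simps power2_eq_square)
    finally have "w * omit2 ws + omit1 ws \<le> w * omit0 ws * ((1 / w + s)\<^sup>2 / 2)" .
    then show ?case using w IH by (simp add: s_def[symmetric] field_simps)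
  qed auto
  then show "omit0 ws > 0" "omit1 ws = omit0 ws * s" "omit2 ws \<le> omit0 ws * (s\<^sup>2 / 2)" "s \<ge> 0" by auto
qed

lemma omit0_exp_le:
  assumes "\<And>x. x \<in> set xs \<Longrightarrow> 0 < w x \<and> w x * exp (r / w x) \<le> rho ^ n x"
  shows "omit0 (map w xs) * exp (r * sum_list (map (\<lambda>x. 1 / w x) xs)) \<le> rho ^ sum_list (map n xs)"
  using assms
proof (induction xs)
  case (Cons x xs)
  have "omit0 (map w xs) > 0" using symmetric_sums(1)[of "map w xs"] Cons.prems by auto
  then have "(w x * exp (r / w x)) * (omit0 (map w xs) * exp (r * sum_list (map (\<lambda>x. 1 / w x) xs)))
    \<le> rho ^ n x * rho ^ sum_list (map n xs)"
    using Cons by (intro mult_mono) (auto intro: less_imp_le)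
  then show ?case by (simp add: exp_add power_add algebra_simps)
qed simp

text \<open>
  The quadratic in the reciprocal sum is traded for an exponential, which is multiplicative over the
  entries.
\<close>
lemma config_bound_exp_le:
  assumes "\<And>x. x \<in> set xs \<Longrightarrow> 0 < w x \<and> w x * exp (r / w x) \<le> rho ^ n x"
      and "\<And>s. 0 \<le> s \<Longrightarrow> (real l + 1) + (real l + 2) * s + s\<^sup>2 / 2 \<le> C * exp (r * s)"
  shows "config_bound l (map w xs) \<le> C * rho ^ sum_list (map n xs)"
proof -
  define s where "s = sum_list (map (\<lambda>x. 1 / w x) xs)"
  have S: "omit0 (map w xs) > 0" "omit1 (map w xs) = omit0 (map w xs) * s" "omit2 (map w xs) \<le> omit0 (map w xs) * (s\<^sup>2 / 2)" "s \<ge> 0"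
    using symmetric_sums[of "map w xs"] assms(1) by (auto simp: s_def comp_def)
  have C: "C \<ge> 0" using assms(2)[of 0] by simp
  have "config_bound l (map w xs) \<le> omit0 (map w xs) * ((real l + 1) + (real l + 2) * s + s\<^sup>2 / 2)"
    using S by (simp add: config_bound_def algebra_simps)
  also have "\<dots> \<le> omit0 (map w xs) * (C * exp (r * s))"
    using S assms(2)[of s] by (intro mult_left_mono) auto
  also have "\<dots> = C * (omit0 (map w xs) * exp (r * s))" by simp
  also have "\<dots> \<le> C * rho ^ sum_list (map n xs)"
    unfolding s_def using C omit0_exp_le[of xs w r n] assms(1) by (intro mult_left_mono) auto
  finally show ?thesis .
qed

text \<open>
  The same for a list with one distinguished entry 4, the weight of a spider: its factor
  $4 e^{r/4}$ exceeds $\rho^4 = 5$, so its contribution has to stay inside the quadratic.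
\<close>
lemma config_bound_4_exp_le:
  assumes "\<And>x. x \<in> set xs \<Longrightarrow> 0 < w x \<and> w x * exp (r / w x) \<le> rho ^ n x"
      and "\<And>s. 0 \<le> s \<Longrightarrow> (5 * real l + 6) + (4 * real l + 9) * s + 2 * s\<^sup>2 \<le> C * exp (r * s)"
  shows "config_bound l (4 # map w xs) \<le> C * rho ^ sum_list (map n xs)"
proof -
  define s where "s = sum_list (map (\<lambda>x. 1 / w x) xs)"
  have S: "omit0 (map w xs) > 0" "omit1 (map w xs) = omit0 (map w xs) * s" "omit2 (map w xs) \<le> omit0 (map w xs) * (s\<^sup>2 / 2)" "s \<ge> 0"
    using symmetric_sums[of "map w xs"] assms(1) by (auto simp: s_def comp_def)
  have C: "C \<ge> 0" using assms(2)[of 0] by simp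
  have "config_bound l (4 # map w xs) \<le> omit0 (map w xs) * ((5 * real l + 6) + (4 * real l + 9) * s + 2 * s\<^sup>2)"
    using S by (simp add: config_bound_def algebra_simps)
  also have "\<dots> \<le> omit0 (map w xs) * (C * exp (r * s))"
    using S assms(2)[of s] by (intro mult_left_mono) auto
  also have "\<dots> = C * (omit0 (map w xs) * exp (r * s))" by simp
  also have "\<dots> \<le> C * rho ^ sum_list (map n xs)"
    unfolding s_def using C omit0_exp_le[of xs w r n] assms(1) by (intro mult_left_mono) auto
  finally show ?thesis .
qed

text \<open>
  As $v e^{r/v} \approx v + r + r^2/v$ increases for $v \ge r$, it suffices to test the largest weight.
\<close>
lemma weight_exp_le:
  assumes "1 \<le> r" "r \<le> v" "v \<le> W" "W + r + r\<^sup>2 / W \<le> (B::real)"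
  shows "v * exp (r / v) \<le> B"
proof -
  have v: "v > 0" "W > 0" using assms by linarith+
  have "exp (r / v) \<le> 1 + r / v + (r / v)\<^sup>2"
    using assms v by (intro exp_bound) auto
  then have "v * exp (r / v) \<le> v * (1 + r / v + (r / v)\<^sup>2)"
    using v by (intro mult_left_mono) auto
  also have "\<dots> = v + r + r\<^sup>2 / v" using v by (simp add: field_simps power2_eq_square)
  also have "\<dots> \<le> W + r + r\<^sup>2 / W"
  proof -
    have "r\<^sup>2 \<le> v * W" unfolding power2_eq_square using assms by (intro mult_mono) auto
    then have "0 \<le> (W - v) * (v * W - r\<^sup>2)" using assms by simp
    then have "v * v * W + r\<^sup>2 * W \<le> W * W * v + r\<^sup>2 * v" by (simp add: algebra_simps)
    then have "v + r\<^sup>2 / v \<le> W + r\<^sup>2 / W" using v by (simp add: field_simps)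
    then show ?thesis by simp
  qed
  finally show ?thesis using assms by simp
qed

lemma exp_half_less: "exp (1/2) < (1.67::real)"
proof -
  have "exp (1/2) = exp (1/32::real) ^ 16" by (simp flip: exp_of_nat_mult)
  also have "\<dots> \<le> (1 + 1/32 + (1/32)\<^sup>2) ^ 16"
    by (intro power_mono exp_bound) auto
  also have "\<dots> < (1.67::real)" by (simp add: power_divide)
  finally show ?thesis .
qed

section \<open>The upper bound for rooted trees\<close>

text \<open>
  A linear function that grows by a factor of at most 1.49 in the first step stays below a geometric
  progression with ratio \<^term>\<open>rho\<close>. This disposes of large numbers of one-vertex branches.
\<close>
lemma linear_le_rho_power:
  assumes "a + b * real k \<le> C" "0 \<le> b" "b \<le> 49/100 * (a + b * real k)" "k \<le> l"
  shows "a + b * real l \<le> C * rho ^ (l - k)"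
  using assms(4)
proof (induction l rule: dec_induct)
  case base
  then show ?case using assms(1) by simp
next
  case (step l)
  have "a + b * real (Suc l) \<le> 149/100 * (a + b * real l)"
    using assms(2,3) step(1) mult_left_mono[of "real k" "real l" b] by (auto simp: algebra_simps)
  also have "\<dots> \<le> rho * (a + b * real l)"
    using assms(2,3) step(1) rho_gt mult_left_mono[of "real k" "real l" b]
    by (intro mult_right_mono) auto
  also have "\<dots> \<le> rho * (C * rho ^ (l - k))"
    using step.IH rho_pos by (intro mult_left_mono) auto
  finally show ?case using step(1) by (simp add: Suc_diff_le mult_ac)
qed

lemma rho_power_split: "a + b = c \<Longrightarrow> rho ^ a * rho ^ b = rho ^ c"
  by (metis power_add)

lemma linear_le_rho_power':
  assumes "a + b * real k \<le> 99/100 * rho ^ m" "0 \<le> b" "b \<le> 49/100 * (a + b * real k)" "k \<le> l" "m + (l - k) = n"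
  shows "a + b * real l \<le> 99/100 * rho ^ n"
  using linear_le_rho_power[OF assms(1-4)] rho_power_split[OF assms(5)] by simp

lemma rsize_pos [simp]: "0 < rsize t"
  by (cases t) auto

lemma rsize_neq_0 [simp]: "rsize t \<noteq> 0"
  using rsize_pos[of t] by simp

lemma rsize_eq_0_iff: "(\<Sum>t\<in>#M. rsize t) = 0 \<longleftrightarrow> M = {#}"
  by (cases M) auto

lemma rsize_eq_1_iff: "rsize t = 1 \<longleftrightarrow> t = leaf"
proof (cases t)
  case (Node M)
  then show ?thesis using rsize_eq_0_iff[of M] by (cases M) auto
qed

lemma rsize_eq_2_iff: "rsize t = 2 \<longleftrightarrow> t = twig"
proof
  assume "rsize t = 2"
  then obtain M where M: "t = Node M" "(\<Sum>t\<in>#M. rsize t) = 1" by (cases t) auto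
  then obtain s K where K: "M = add_mset s K" by (cases M) auto
  then have "rsize s = 1 \<and> (\<Sum>t\<in>#K. rsize t) = 0" using M(2) rsize_pos[of s]
    by (metis One_nat_def add_is_1 image_mset_add_mset rsize_neq_0 sum_mset.insert)
  then show "t = twig" using M K by (metis rsize_eq_0_iff rsize_eq_1_iff)
qed auto

lemma split_leaves: "\<exists>l ts. M = replicate_mset l leaf + mset ts \<and> (\<forall>t\<in>set ts. 2 \<le> rsize t)"
proof (induction M)
  case empty
  show ?case by (intro exI[of _ 0] exI[of _ "[]"]) auto
next
  case (add s M)
  then obtain l ts where IH: "M = replicate_mset l leaf + mset ts" "\<forall>t\<in>set ts. 2 \<le> rsize t" by auto
  show ?case
  proof (cases "s = leaf")
    case True
    then show ?thesis using IH by (intro exI[of _ "Suc l"] exI[of _ ts]) auto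
  next
    case False
    then have "2 \<le> rsize s" using rsize_eq_1_iff[of s] rsize_pos[of s] by linarith
    then show ?thesis using IH by (intro exI[of _ l] exI[of _ "s # ts"]) auto
  qed
qed

lemma self_in_rsub: "t \<in> rsub t"
proof (induction t)
  case (Node M)
  then have "M \<in> forests M"
  proof (induction M)
    case (add s M)
    then have "{#s#} + M \<in> choices (rsub s) + forests M"
      by (intro set_plus_intro) (auto simp: choices_def)
    then show ?case by simp
  qed simp
  then show ?case by (simp add: rsub_Node)
qed

lemma card_rsub_ge_2: "2 \<le> rsize t \<Longrightarrow> 2 \<le> card (rsub t)"
  using card_mono[of "rsub t" "{leaf, twig}"] twig_in_rsub[of t] by simp

lemma card_rsub_ge_3: "3 \<le> rsize t \<Longrightarrow> 3 \<le> card (rsub t)"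
proof -
  assume *: "3 \<le> rsize t"
  then have "{leaf, twig, t} \<subseteq> rsub t" "t \<noteq> leaf" "t \<noteq> twig"
    using twig_in_rsub[of t] self_in_rsub[of t] by auto
  then show ?thesis using card_mono[of "rsub t" "{leaf, twig, t}"] by simp
qed

text \<open>
  The extremal tree: 4 vertices, 5 shapes, attached along the spine of the tree in the lower bound.
\<close>
definition spider :: rtree where
  "spider = Node {#leaf, twig#}"

lemma rsize_spider [simp]: "rsize spider = 4"
  by (simp add: spider_def)

text \<open>
  The spider is the only rooted tree with 4 vertices and 5 shapes. Hence two branches of this kind are
  equal.
\<close>
lemma card_rsub_size_4:
  assumes "rsize t = 4" "t \<noteq> spider" "\<And>s. rsize s = 3 \<Longrightarrow> card (rsub s) \<le> 3"
  shows "card (rsub t) \<le> 4"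
proof -
  obtain M where t: "t = Node M" by (cases t)
  obtain l ts where M: "M = replicate_mset l leaf + mset ts" and ts: "\<And>t. t \<in> set ts \<Longrightarrow> 2 \<le> rsize t"
    using split_leaves[of M] by blast
  have sum: "l + sum_list (map rsize ts) = 3"
    using assms(1) by (simp add: t M sum_mset_sum_list flip: mset_map)
  have bd: "real (card (rsub t)) \<le> config_bound l (map (\<lambda>t. real (card (rsub t)) - 1) ts)"
    unfolding t card_rsub M by (rule card_forests_le) (use ts in auto)
  consider "ts = []" | a where "ts = [a]" | a b us where "ts = a # b # us"
    by (metis neq_Nil_conv)
  then have "real (card (rsub t)) \<le> 4"
  proof cases
    case 1
    then show ?thesis using bd sum by (simp add: config_bound_def)
  next
    case 2
    have "rsize a \<noteq> 2"
    proof
      assume "rsize a = 2"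
      then have "l = 1" "a = twig" using sum 2 by (auto simp: rsize_eq_2_iff)
      then show False using assms(2) by (auto simp: t M 2 spider_def)
    qed
    then have "rsize a = 3" "l = 0" using sum ts[of a] 2 by auto
    then show ?thesis using bd assms(3)[of a] 2 by (simp add: config_bound_def)
  next
    case 3
    then show ?thesis using sum ts[of a] ts[of b] by auto
  qed
  then show ?thesis by simp
qed

lemma quadratic_nonneg:
  fixes a b c s :: real
  assumes "b\<^sup>2 \<le> 4 * a * c" "c > 0"
  shows "0 \<le> a + b * s + c * s\<^sup>2"
proof -
  have "4 * c * (a + b * s + c * s\<^sup>2) = (4 * a * c - b\<^sup>2) + (2 * c * s + b)\<^sup>2"
    by (simp add: power2_eq_square algebra_simps)
  then have "0 \<le> 4 * c * (a + b * s + c * s\<^sup>2)" using assms by simp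
  then show ?thesis using assms(2) by (simp add: zero_le_mult_iff)
qed

text \<open>
  The quadratics are those of \<open>config_bound_exp_le\<close> and \<open>config_bound_4_exp_le\<close> for $l = 0$, $l = 1$ and
  $l \ge 2$. The constants on the right are chosen below $\rho^{l+1}$ and $\rho^{l+5}$ respectively. For
  $l = 0$ branches with three vertices occur, which rules out the rate 21/20; for $l \ge 1$ this rate is
  available, and the case $l = 1$ with a spider needs it (11.12 against $\rho^6 \approx 11.18$).
\<close>
lemma poly_exp_bounds:
  fixes s :: real
  assumes "0 \<le> s"
  shows "1 + 2 * s + s\<^sup>2 / 2 \<le> 142/100 * exp (1 * s)"
    and "6 + 9 * s + 2 * s\<^sup>2 \<le> 7 * exp (1 * s)"
    and "2 + 3 * s + s\<^sup>2 / 2 \<le> 219/100 * exp (21/20 * s)"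
    and "11 + 13 * s + 2 * s\<^sup>2 \<le> 1112/100 * exp (21/20 * s)"
    and "2 \<le> l \<Longrightarrow> (real l + 1) + (real l + 2) * s + s\<^sup>2 / 2 \<le> (real l + 12/10) * exp (21/20 * s)"
    and "2 \<le> l \<Longrightarrow> (5 * real l + 6) + (4 * real l + 9) * s + 2 * s\<^sup>2 \<le> (5 * real l + 65/10) * exp (21/20 * s)"
proof -
  have E1: "1 + s + s\<^sup>2 / 2 \<le> exp (1 * s)" using exp_quadratic_le[of s] assms by simp
  have E2: "1 + 21/20 * s + 441/800 * s\<^sup>2 \<le> exp (21/20 * s)"
    using exp_quadratic_le[of "21/20 * s"] assms by (simp add: power2_eq_square)
  have "0 \<le> 42/100 + (-58/100) * s + (21/100) * s\<^sup>2"
    by (rule quadratic_nonneg) (simp_all add: power_divide)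
  then show "1 + 2 * s + s\<^sup>2 / 2 \<le> 142/100 * exp (1 * s)"
    using E1 zero_le_power2[of s] by linarith
  have "0 \<le> 1 + (-2) * s + (3/2) * s\<^sup>2"
    by (rule quadratic_nonneg) (simp_all add: power_divide)
  then show "6 + 9 * s + 2 * s\<^sup>2 \<le> 7 * exp (1 * s)"
    using E1 zero_le_power2[of s] by linarith
  have "0 \<le> 19/100 + (-7005/10000) * s + (70/100) * s\<^sup>2"
    by (rule quadratic_nonneg) (simp_all add: power_divide)
  then show "2 + 3 * s + s\<^sup>2 / 2 \<le> 219/100 * exp (21/20 * s)"
    using E2 zero_le_power2[of s] by linarith
  have "0 \<le> 12/100 + (-1324/1000) * s + (4129/1000) * s\<^sup>2"
    by (rule quadratic_nonneg) (simp_all add: power_divide)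
  then show "11 + 13 * s + 2 * s\<^sup>2 \<le> 1112/100 * exp (21/20 * s)"
    using E2 zero_le_power2[of s] by linarith
  assume l: "2 \<le> l"
  define m where "m = real l - 2"
  have m: "m \<ge> 0" "real l = m + 2" using l by (auto simp: m_def)
  define q where "q = s\<^sup>2"
  have ms: "m * s \<ge> 0" "m * q \<ge> 0" "q \<ge> 0" using m assms by (auto simp: q_def)
  have E3: "(real l + 12/10) * (1 + 21/20 * s + 441/800 * s\<^sup>2) \<le> (real l + 12/10) * exp (21/20 * s)"
    using E2 by (intro mult_left_mono) auto
  show "(real l + 1) + (real l + 2) * s + s\<^sup>2 / 2 \<le> (real l + 12/10) * exp (21/20 * s)"
  proof -
    have e1: "(m + 2 + 12/10) * (1 + 21/20 * s + 441/800 * q)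
        = m + 16/5 + 21/20 * (m * s) + 336/100 * s + 441/800 * (m * q) + 16/5 * 441/800 * q"
      by (simp add: field_simps)
    have e2: "(m + 2 + 1) + (m + 2 + 2) * s + q / 2 = m + 3 + m * s + 4 * s + q / 2"
      by (simp add: algebra_simps)
    have e3: "0 \<le> 2/10 + (-64/100) * s + 1 * q"
      unfolding q_def by (rule quadratic_nonneg) (simp_all add: power_divide)
    have "m + 3 + m * s + 4 * s + q / 2
        \<le> m + 16/5 + 21/20 * (m * s) + 336/100 * s + 441/800 * (m * q) + 16/5 * 441/800 * q"
      using e3 ms by linarith
    then show ?thesis using E3 unfolding m(2) q_def[symmetric] e1 e2 by (rule order.trans)
  qed
  have E4: "(5 * real l + 65/10) * (1 + 21/20 * s + 441/800 * s\<^sup>2) \<le> (5 * real l + 65/10) * exp (21/20 * s)"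
    using E2 by (intro mult_left_mono) auto
  show "(5 * real l + 6) + (4 * real l + 9) * s + 2 * s\<^sup>2 \<le> (5 * real l + 65/10) * exp (21/20 * s)"
  proof -
    have e1: "(5 * (m + 2) + 65/10) * (1 + 21/20 * s + 441/800 * q)
        = 5 * m + 33/2 + 21/4 * (m * s) + 693/40 * s + 441/160 * (m * q) + 33/2 * 441/800 * q"
      by (simp add: field_simps)
    have e2: "(5 * (m + 2) + 6) + (4 * (m + 2) + 9) * s + 2 * q = 5 * m + 16 + 4 * (m * s) + 17 * s + 2 * q"
      by (simp add: algebra_simps)
    have "5 * m + 16 + 4 * (m * s) + 17 * s + 2 * q
        \<le> 5 * m + 33/2 + 21/4 * (m * s) + 693/40 * s + 441/160 * (m * q) + 33/2 * 441/800 * q"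
      using ms assms by linarith
    then show ?thesis using E4 unfolding m(2) q_def[symmetric] e1 e2 by (rule order.trans)
  qed
qed

text \<open>
  The gap of 1/4 from 8 vertices on is what allows the rate 21/20 for large branches in the induction;
  for fewer vertices integrality plays this role. Small trees have to be exempt since the spider attains
  \<^term>\<open>rho ^ 4\<close>.
\<close>
definition within_bound :: "nat \<Rightarrow> real \<Rightarrow> bool" where
  "within_bound n N \<longleftrightarrow> N \<le> rho ^ n \<and> (8 \<le> n \<longrightarrow> N \<le> rho ^ n - 1/4)"

text \<open>
  A relative gap of one per cent suffices because $\rho^8 = 25$.
\<close>
lemma within_boundI: "N \<le> 99/100 * rho ^ n \<Longrightarrow> within_bound n N"
proof -
  assume *: "N \<le> 99/100 * rho ^ n"
  have "0 < rho ^ n" by simp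
  then have "N \<le> rho ^ n" using * by linarith
  moreover have "N \<le> rho ^ n - 1/4" if "8 \<le> n" using rho_pow_ge_25[OF that] * by linarith
  ultimately show ?thesis by (simp add: within_bound_def)
qed

lemma within_bound_small:
  assumes "within_bound n (real N)"
  shows "n = 2 \<Longrightarrow> N \<le> 2" "n = 3 \<Longrightarrow> N \<le> 3" "n = 4 \<Longrightarrow> N \<le> 5"
    "n = 5 \<Longrightarrow> N \<le> 7" "n = 6 \<Longrightarrow> N \<le> 11" "n = 7 \<Longrightarrow> N \<le> 16"
proof -
  have N: "real N \<le> rho ^ n" using assms by (simp add: within_bound_def)
  show "n = 2 \<Longrightarrow> N \<le> 2" "n = 3 \<Longrightarrow> N \<le> 3" "n = 4 \<Longrightarrow> N \<le> 5"
    "n = 5 \<Longrightarrow> N \<le> 7" "n = 6 \<Longrightarrow> N \<le> 11" "n = 7 \<Longrightarrow> N \<le> 16"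
    using N rho_powers_lt rho_pow4 by auto
qed

text \<open>
  The entries $w = N - 1$ that may be distributed over the exponential. For $n \le 7$ the
  number $N$ is at most the integral part of \<^term>\<open>rho ^ n\<close>, and the spider, with $n = 4$ and $N = 5$, is
  excluded. The estimate is closest for $n = 6$, where $10 + 1.05 + 0.11 < 11.18$.
\<close>
lemma weight_bounds:
  assumes N: "within_bound n (real N)" and n: "3 \<le> n" "3 \<le> N" and r: "r = 1 \<and> n = 3 \<or> (r = 1 \<or> r = 21/20) \<and> 4 \<le> n"
      and 4: "n = 4 \<Longrightarrow> N \<le> 4"
  shows "0 < real N - 1 \<and> (real N - 1) * exp (r / (real N - 1)) \<le> rho ^ n"
proof -
  have main: "(real N - 1) * exp (21/20 / (real N - 1)) \<le> rho ^ n" if "4 \<le> n"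
  proof -
    \<comment> \<open>the largest value that \<^term>\<open>real N - 1\<close> can take\<close>
    define W where "W = (if n = 4 then 3 else if n = 5 then 6 else if n = 6 then 10 else if n = 7 then 15
      else rho ^ n - 5/4)"
    have "n = 4 \<or> n = 5 \<or> n = 6 \<or> n = 7 \<or> 8 \<le> n" using that by auto
    moreover have "real N - 1 \<le> W" if "8 \<le> n"
      using that N by (simp add: W_def within_bound_def)
    ultimately have 1: "real N - 1 \<le> W"
      using within_bound_small[OF N] 4 by (elim disjE) (auto simp: W_def)
    have "W + 21/20 + (21/20)\<^sup>2 / W \<le> rho ^ n" if "8 \<le> n"
    proof -
      have "W \<ge> 23" using rho_pow_ge_25[OF that] that by (simp add: W_def)
      then have "(21/20)\<^sup>2 / W \<le> (21/20)\<^sup>2 / 23" by (intro divide_left_mono) auto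
      then show ?thesis using that by (simp add: W_def power2_eq_square)
    qed
    then have 2: "W + 21/20 + (21/20)\<^sup>2 / W \<le> rho ^ n"
      using \<open>n = 4 \<or> n = 5 \<or> n = 6 \<or> n = 7 \<or> 8 \<le> n\<close> rho_powers_gt rho_pow4
      by (elim disjE) (auto simp: W_def power2_eq_square)
    show ?thesis using weight_exp_le[of "21/20" "real N - 1" W, OF _ _ 1 2] n by simp
  qed
  have three: "(real N - 1) * exp (1 / (real N - 1)) \<le> rho ^ n" if "n = 3"
  proof -
    have "N = 3" using n within_bound_small(2)[OF N that] by simp
    then show ?thesis using exp_half_less rho_powers_gt that by simp
  qed
  have "(real N - 1) * exp (1 / (real N - 1)) \<le> (real N - 1) * exp (21/20 / (real N - 1))"
    using n by (intro mult_left_mono) (auto simp: field_simps)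
  note le = this
  consider "r = 1" "n = 3" | "r = 1" "4 \<le> n" | "r = 21/20" "4 \<le> n" using r by blast
  then have "(real N - 1) * exp (r / (real N - 1)) \<le> rho ^ n"
  proof cases
    case 1
    show ?thesis unfolding 1(1) by (rule three[OF 1(2)])
  next
    case 2
    show ?thesis unfolding 2(1) by (rule order.trans[OF le main[OF 2(2)]])
  next
    case 3
    show ?thesis unfolding 3(1) by (rule main[OF 3(2)])
  qed
  then show ?thesis using n by simp
qed

text \<open>
  The base configurations are $2l + 3$ against $\rho^{l+3}$ for a two-vertex branch, and $3l + 4$ against
  $\rho^{l+4}$ for a three-vertex branch. Both have a gap of one per cent, except for one leaf and one
  two-vertex branch, i.e. the spider, where equality holds and the subtracted 1 is used instead.
\<close>
lemma config_bound_branches_case_A: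
  assumes within_bound: "\<And>t. t \<in> set xs \<Longrightarrow> 2 \<le> rsize t \<and> within_bound (rsize t) (real (card (rsub t)))"
      and s: "rsize s = 2 \<or> rsize s = 3 \<and> 1 \<le> l" "card (rsub s) = rsize s"
  defines "w \<equiv> \<lambda>t. real (card (rsub t)) - 1"
  shows "within_bound (1 + l + sum_list (map rsize xs) + rsize s) (config_bound l (map w xs @ [w s]))"
proof -
  define S where "S = sum_list (map rsize xs)"
  have xs: "1 \<le> w x \<and> w x + 1 \<le> rho ^ rsize x" if "x \<in> set xs" for x
    using within_bound[OF that] card_rsub_ge_2[of x] by (auto simp: w_def within_bound_def)
  have "w s = real (rsize s) - 1" using s by (simp add: w_def)
  then have ws: "1 \<le> w s" "w s \<le> real l + 1" using s by auto
  note B = config_bound_append_base[of xs w rsize, OF xs ws, folded S_def]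
  show ?thesis
  proof (cases "rsize s = 2 \<and> l = 1")
    case True
    then have b: "w s = 1" "config_bound l [w s] = rho ^ 4" using s rho_pow4 by (auto simp: w_def config_bound_def)
    have eq: "rho ^ (1 + l + S + rsize s) = rho ^ 4 * rho ^ S" using True by (simp add: power_add rho_pow4 eval_nat_numeral)
    show ?thesis
    proof (cases "xs = []")
      case False
      then show ?thesis using B(2) True b unfolding S_def[symmetric] within_bound_def eq by auto
    next
      case nil: True
      then show ?thesis using B(1) True b unfolding S_def[symmetric] within_bound_def eq
        by (auto simp: S_def)
    qed
  next
    case False
    have "config_bound l [w s] \<le> 99/100 * rho ^ (1 + l + rsize s)"
    proof (cases "rsize s = 2")
      case two: True
      then have b: "config_bound l [w s] = 3 + 2 * real l" using s by (simp add: w_def config_bound_def)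
      show ?thesis
      proof (cases "l = 0")
        case True
        then have "1 + l + rsize s = 3" using two by simp
        then show ?thesis using b True rho_powers_gt(3) by (simp only: of_nat_0)
      next
        case nz: False
        then have l: "2 \<le> l" using False two by linarith
        have "3 + 2 * real l \<le> 99/100 * rho ^ (1 + l + rsize s)"
          by (rule linear_le_rho_power'[where m = 5 and k = 2]) (use l two rho_powers_gt in auto)
        then show ?thesis by (simp only: b)
      qed
    next
      case False
      then have l: "1 \<le> l" "rsize s = 3" using s by auto
      have b: "config_bound l [w s] = 4 + 3 * real l" using s l by (simp add: w_def config_bound_def)
      have "4 + 3 * real l \<le> 99/100 * rho ^ (1 + l + rsize s)"
        by (rule linear_le_rho_power'[where m = 5 and k = 1]) (use l rho_powers_gt in auto)
      then show ?thesis by (simp only: b)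
    qed
    then have "config_bound l [w s] * rho ^ S \<le> 99/100 * rho ^ (1 + l + rsize s) * rho ^ S"
      by (intro mult_right_mono) (auto intro: less_imp_le)
    also have "\<dots> = 99/100 * rho ^ (1 + l + S + rsize s)" by (simp add: power_add mult_ac)
    finally show ?thesis using B(1) unfolding S_def[symmetric] by (intro within_boundI) simp
  qed
qed

text \<open>
  The exponential estimate applies to all branches except a spider, which the second statement adds.
  Constants and rate depend on \<^term>\<open>l\<close> as in \<open>poly_exp_bounds\<close>.
\<close>
lemma config_bound_branches_case_B:
  assumes within_bound: "\<And>t. t \<in> set xs \<Longrightarrow> within_bound (rsize t) (real (card (rsub t)))"
      and size: "\<And>t. t \<in> set xs \<Longrightarrow> 3 \<le> rsize t \<and> (rsize t = 3 \<longrightarrow> l = 0) \<and> (rsize t = 4 \<longrightarrow> card (rsub t) \<le> 4)"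
  defines "w \<equiv> \<lambda>t. real (card (rsub t)) - 1"
  shows "within_bound (1 + l + sum_list (map rsize xs)) (config_bound l (map w xs))"
    and "within_bound (5 + l + sum_list (map rsize xs)) (config_bound l (4 # map w xs))"
proof -
  define S where "S = sum_list (map rsize xs)"
  have W: "0 < w x \<and> w x * exp (r / w x) \<le> rho ^ rsize x"
    if "x \<in> set xs" "r = 1 \<and> l = 0 \<or> r = 21/20 \<and> l \<noteq> 0" for x r
    unfolding w_def using within_bound[OF that(1)] size[OF that(1)] card_rsub_ge_3[of x] that(2)
    by (intro weight_bounds) auto
  have W0: "0 < w x \<and> w x * exp (1 / w x) \<le> rho ^ rsize x" if "l = 0" "x \<in> set xs" for x
    using W[OF that(2), of 1] that by blast
  have W1: "0 < w x \<and> w x * exp (21/20 / w x) \<le> rho ^ rsize x" if "0 < l" "x \<in> set xs" for x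
    using W[OF that(2), of "21/20"] that by blast
  have fin: "within_bound (k + S) N" if "N \<le> C * rho ^ S" "C \<le> 99/100 * rho ^ k" for k N C
  proof (rule within_boundI)
    have "C * rho ^ S \<le> 99/100 * rho ^ k * rho ^ S"
      by (rule mult_right_mono[OF that(2)]) (simp add: less_imp_le)
    with that(1) have "N \<le> 99/100 * rho ^ k * rho ^ S" by (rule order.trans)
    then show "N \<le> 99/100 * rho ^ (k + S)" by (simp only: power_add mult.assoc)
  qed
  consider "l = 0" | "l = 1" | "2 \<le> l" by linarith
  then have "within_bound (1 + l + S) (config_bound l (map w xs)) \<and> within_bound (5 + l + S) (config_bound l (4 # map w xs))"
  proof cases
    case 1
    have A: "config_bound l (map w xs) \<le> 142/100 * rho ^ S" unfolding S_def
      by (rule config_bound_exp_le[where r = 1, OF W0]) (use 1 poly_exp_bounds(1) in auto)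
    have B: "config_bound l (4 # map w xs) \<le> 7 * rho ^ S" unfolding S_def
      by (rule config_bound_4_exp_le[where r = 1, OF W0]) (use 1 poly_exp_bounds(2) in auto)
    have "within_bound (1 + S) (config_bound l (map w xs))" "within_bound (5 + S) (config_bound l (4 # map w xs))"
      using rho_powers_gt by (auto intro: fin[OF A, of 1, simplified] fin[OF B, of 5])
    then show ?thesis using 1 by simp
  next
    case 2
    have "config_bound l (map w xs) \<le> 219/100 * rho ^ S" unfolding S_def
      by (rule config_bound_exp_le[where r = "21/20", OF W1]) (use 2 poly_exp_bounds(3) in auto)
    then have A: "within_bound (2 + S) (config_bound l (map w xs))" using rho_powers_gt by (intro fin[of _ "219/100" 2]) auto
    have "within_bound (6 + S) (config_bound l (4 # map w xs))"
    proof (cases "xs = []")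
      case True
      then show ?thesis using 2 rho_powers_gt by (simp add: within_bound_def config_bound_def S_def)
    next
      case False
      \<comment> \<open>1112/100 is too close to \<^term>\<open>rho ^ 6\<close> for a gap of one per cent; the absolute gap suffices
        because every other branch has at least 4 vertices.\<close>
      have B: "config_bound l (4 # map w xs) \<le> 1112/100 * rho ^ S" unfolding S_def
        by (rule config_bound_4_exp_le[where r = "21/20", OF W1]) (use 2 poly_exp_bounds(4) in auto)
      obtain y ys where y: "xs = y # ys" using False by (cases xs) auto
      then have "4 \<le> S" using size[of y] 2 by (auto simp: S_def)
      then have "5 \<le> rho ^ S" using rho_pow_mono[of 4 S] rho_pow4 by simp
      then have "1112/100 * rho ^ S \<le> (111799/10000) * rho ^ S - 1/4" by simp
      also have "(111799/10000) * rho ^ S \<le> rho ^ 6 * rho ^ S"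
        using rho_powers_gt by (intro mult_right_mono) (auto intro: less_imp_le)
      finally show ?thesis using B unfolding within_bound_def by (auto simp: power_add)
    qed
    then show ?thesis using A 2 by (simp add: numeral_eq_Suc)
  next
    case 3
    have "config_bound l (map w xs) \<le> (real l + 12/10) * rho ^ S" unfolding S_def
      by (rule config_bound_exp_le[where r = "21/20", OF W1]) (use 3 poly_exp_bounds(5) in auto)
    moreover have "12/10 + 1 * real l \<le> 99/100 * rho ^ (1 + l)"
      by (rule linear_le_rho_power'[where m = 3 and k = 2]) (use 3 rho_powers_gt in auto)
    then have "real l + 12/10 \<le> 99/100 * rho ^ (1 + l)" by (simp only: mult_1_left add.commute)
    ultimately have A: "within_bound (1 + l + S) (config_bound l (map w xs))" by (rule fin)
    have "config_bound l (4 # map w xs) \<le> (5 * real l + 65/10) * rho ^ S" unfolding S_def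
      by (rule config_bound_4_exp_le[where r = "21/20", OF W1]) (use 3 poly_exp_bounds(6) in auto)
    moreover have "65/10 + 5 * real l \<le> 99/100 * rho ^ (5 + l)"
      by (rule linear_le_rho_power'[where m = 7 and k = 2]) (use 3 rho_powers_gt in auto)
    then have "5 * real l + 65/10 \<le> 99/100 * rho ^ (5 + l)" by (simp only: add.commute)
    ultimately have "within_bound (5 + l + S) (config_bound l (4 # map w xs))" by (rule fin)
    then show ?thesis using A by simp
  qed
  then show "within_bound (1 + l + sum_list (map rsize xs)) (config_bound l (map w xs))"
    and "within_bound (5 + l + sum_list (map rsize xs)) (config_bound l (4 # map w xs))" by (auto simp: S_def)
qed

lemma omit_move_to_front:
  "omit0 (xs @ y # ys) = omit0 (y # xs @ ys)" "omit1 (xs @ y # ys) = omit1 (y # xs @ ys)" "omit2 (xs @ y # ys) = omit2 (y # xs @ ys)"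
  by (induction xs) (auto simp: algebra_simps)

text \<open>
  The order of the branches is immaterial, so a distinguished branch can be moved to either end.
\<close>
lemma config_bound_mset_cong: "mset xs = mset ys \<Longrightarrow> config_bound l xs = config_bound l ys"
proof -
  have "mset xs = mset ys \<Longrightarrow> omit0 xs = omit0 ys \<and> omit1 xs = omit1 ys \<and> omit2 xs = omit2 ys"
  proof (induction xs arbitrary: ys)
    case (Cons x xs)
    then obtain as bs where ys: "ys = as @ x # bs"
      by (metis list.set_intros(1) set_mset_mset split_list)
    then have "mset xs = mset (as @ bs)" using Cons.prems by simp
    then show ?case using Cons.IH[of "as @ bs"] by (simp add: ys omit_move_to_front)
  qed simp
  then show "mset xs = mset ys \<Longrightarrow> config_bound l xs = config_bound l ys" by (simp add: config_bound_def)
qed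

text \<open>
  The rooted upper bound, $N(T) \le \rho^{|T|}$, by induction on the number of vertices.
\<close>
theorem card_rsub_within_bound: "within_bound (rsize t) (real (card (rsub t)))"
proof (induction "rsize t" arbitrary: t rule: less_induct)
  case (less t)
  obtain M where t: "t = Node M" by (cases t)
  obtain l ts where M: "M = replicate_mset l leaf + mset ts" and ts: "\<And>t. t \<in> set ts \<Longrightarrow> 2 \<le> rsize t"
    using split_leaves[of M] by blast
  define w where "w = (\<lambda>t. real (card (rsub t)) - 1)"
  have size: "rsize t = 1 + l + sum_list (map rsize ts)"
    by (simp add: t M sum_mset_sum_list flip: mset_map)
  have bd: "real (card (rsub t)) \<le> config_bound l (map w ts)"
    unfolding t card_rsub M w_def by (rule card_forests_le) (use ts in auto)
  have IH: "within_bound (rsize s) (real (card (rsub s)))" if "s \<in> set ts" for s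
    using less.hyps[of s] that member_le_sum_list[of "rsize s" "map rsize ts"] size by auto
  have mono: "within_bound n N" if "N \<le> N'" "within_bound n N'" for n N N' using that by (auto simp: within_bound_def)
  have reorder: "config_bound l (map w ts) = config_bound l (map w us)" "sum_list (map rsize ts) = sum_list (map rsize us)"
    if "mset us = mset ts" for us
    using that config_bound_mset_cong[of "map w ts" "map w us"] by (auto simp flip: sum_mset_sum_list)
  have two_three: "card (rsub s) = rsize s" if "s \<in> set ts" "rsize s = 2 \<or> rsize s = 3" for s
    using within_bound_small(1,2)[OF IH[OF that(1)]] card_rsub_ge_2[of s] card_rsub_ge_3[of s] that(2) by auto
  show ?case
  proof (cases "2 \<le> count M spider")
    case True
    then obtain K where K: "M = {#spider, spider#} + K"
      by (auto simp: count_le_replicate_mset_subset_eq numeral_2_eq_2 mset_subset_eq_exists_conv)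
    let ?O = "choices (rsub spider)"
    have lt: "rsize (Node K) < rsize t" "rsize t = rsize (Node K) + 8" "rsize spider < rsize t" by (auto simp: t K)
    have "card ?O \<le> 6"
      using within_bound_small(3)[of 4 "card (rsub spider)"] less.hyps[OF lt(3)] by (simp add: card_choices)
    then have "2 * card (?O + ?O) \<le> 6 * (6 + 1)"
      by (intro order.trans[OF card_set_plus_self_le mult_le_mono]) auto
    then have O: "card (?O + ?O) \<le> 21" by simp
    have "card (rsub t) = card (?O + ?O + forests K)"
      unfolding t card_rsub by (simp add: K add_ac)
    also have "\<dots> \<le> card (?O + ?O) * card (forests K)"
      by (intro card_set_plus_le finite_set_plus) auto
    also have "\<dots> \<le> 21 * card (rsub (Node K))"
      unfolding card_rsub using O by (intro mult_right_mono) auto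
    finally have "real (card (rsub t)) \<le> 21 * real (card (rsub (Node K)))" by linarith
    also have "\<dots> \<le> 21 * rho ^ rsize (Node K)"
      using less.hyps[OF lt(1)] by (intro mult_left_mono) (auto simp: within_bound_def)
    also have "\<dots> \<le> 99/100 * (rho ^ 8 * rho ^ rsize (Node K))"
      using rho_pow_ge_25[of 8] mult_right_mono[of 25 "rho ^ 8" "rho ^ rsize (Node K)"]
        rho_pow_pos[of "rsize (Node K)"] by linarith
    also have "\<dots> = 99/100 * rho ^ rsize t" unfolding lt(2) by (simp only: power_add mult_ac)
    finally show ?thesis by (rule within_boundI)
  next
    case no_pair: False
    show ?thesis
    proof (cases "\<exists>s\<in>set ts. rsize s = 2 \<or> rsize s = 3 \<and> 1 \<le> l")
      case True
      then obtain s where s: "s \<in> set ts" "rsize s = 2 \<or> rsize s = 3 \<and> 1 \<le> l" by auto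
      define us where "us = remove1 s ts"
      have us: "mset (us @ [s]) = mset ts" "set us \<subseteq> set ts"
        using s by (auto simp: us_def set_remove1_subset)
      have "within_bound (1 + l + sum_list (map rsize us) + rsize s) (config_bound l (map w us @ [w s]))"
        unfolding w_def using us(2) ts IH s two_three[of s] by (intro config_bound_branches_case_A) auto
      moreover have "rsize t = 1 + l + sum_list (map rsize us) + rsize s"
        using size reorder(2)[OF us(1)] by simp
      moreover have "real (card (rsub t)) \<le> config_bound l (map w us @ [w s])"
        using bd reorder(1)[OF us(1)] by simp
      ultimately show ?thesis by (simp only: mono)
    next
      case False
      have size': "3 \<le> rsize s \<and> (rsize s = 3 \<longrightarrow> l = 0) \<and> (rsize s = 4 \<longrightarrow> card (rsub s) \<le> 4)"
        if "s \<in> set ts" "s \<noteq> spider" for s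
      proof -
        have "card (rsub u) \<le> 3" if "rsize u = 3" "rsize s = 4" for u
        proof -
          have "rsize u < rsize t" using that \<open>s \<in> set ts\<close> member_le_sum_list[of "rsize s" "map rsize ts"] size by auto
          then show ?thesis using less.hyps[of u] within_bound_small(2)[of "rsize u" "card (rsub u)"] that by auto
        qed
        then show ?thesis using that False ts[of s] card_rsub_size_4[of s] by fastforce
      qed
      show ?thesis
      proof (cases "spider \<in> set ts")
        case no_spider: False
        then have "within_bound (1 + l + sum_list (map rsize ts)) (config_bound l (map w ts))"
          unfolding w_def using IH size' by (intro config_bound_branches_case_B(1)) auto
        then show ?thesis using bd size by (auto intro: mono)
      next
        case True
        define us where "us = remove1 spider ts"
        have us: "mset (spider # us) = mset ts" "set us \<subseteq> set ts"
          using True by (auto simp: us_def set_remove1_subset)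
        have "spider \<notin> set us"
        proof
          assume "spider \<in> set us"
          then have "1 \<le> count (mset us) spider" by (metis count_greater_eq_one_iff set_mset_mset)
          moreover have "count (mset ts) spider = Suc (count (mset us) spider)"
            using us(1) by (metis count_add_mset mset.simps(2))
          ultimately have "2 \<le> count (mset ts) spider" by linarith
          then show False using no_pair by (simp add: M)
        qed
        then have "within_bound (5 + l + sum_list (map rsize us)) (config_bound l (4 # map w us))"
          unfolding w_def using us(2) IH size' by (intro config_bound_branches_case_B(2)) auto
        moreover have "config_bound l (map w (spider # us)) \<le> config_bound l (4 # map w us)"
        proof -
          have "w spider \<le> 4"
            using within_bound_small(3)[OF IH[OF True]] by (simp add: w_def)
          moreover have "0 \<le> config_bound l (map w us)"
          proof -
            have "w x \<ge> 0" if "x \<in> set us" for x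
              using us(2) that ts[of x] card_rsub_ge_2[of x] by (auto simp: w_def)
            then show ?thesis unfolding config_bound_def
              by (intro add_nonneg_nonneg mult_nonneg_nonneg omit_nonneg) auto
          qed
          ultimately show ?thesis by (auto simp: config_bound_Cons mult_right_mono)
        qed
        moreover have "rsize t = 5 + l + sum_list (map rsize us)"
          using size reorder(2)[OF us(1)] by simp
        moreover have "real (card (rsub t)) \<le> config_bound l (map w (spider # us))"
          using bd reorder(1)[OF us(1)] by simp
        ultimately show ?thesis by (metis mono order.trans)
      qed
    qed
  qed
qed

section \<open>Subtrees with an arbitrary top vertex\<close>

text \<open>
  The shapes of all subtrees, each rooted at its vertex closest to the root of the whole tree.
\<close>
primrec allsub :: "rtree \<Rightarrow> rtree set" where
  "allsub (Node M) = rsub (Node M) \<union> \<Union> (set_mset (image_mset allsub M))"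

lemma rsub_subset_allsub: "rsub t \<subseteq> allsub t"
  by (cases t) simp

lemma allsub_branch: "s \<in># M \<Longrightarrow> allsub s \<subseteq> allsub (Node M)"
  by auto

text \<open>
  The constant 4 works since $\rho + 4 \cdot 1 \le 4 \rho$. Using $\rho^n - 1$ in place of $\rho^n$ makes the
  right-hand side superadditive in \<^term>\<open>n\<close>, which is needed to sum over the branches.
\<close>
lemma card_allsub_le: "finite (allsub t) \<and> real (card (allsub t)) \<le> 4 * (rho ^ rsize t - 1)"
proof (induction t)
  case (Node M)
  have *: "finite (\<Union> (set_mset (image_mset allsub K))) \<and>
     real (card (\<Union> (set_mset (image_mset allsub K)))) \<le> 4 * (rho ^ (\<Sum>t\<in>#K. rsize t) - 1)" if "K \<subseteq># M" for K
    using that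
  proof (induction K)
    case (add s K)
    let ?U = "\<Union> (set_mset (image_mset allsub K))"
    have s: "finite (allsub s)" "real (card (allsub s)) \<le> 4 * (rho ^ rsize s - 1)"
      using Node.IH[of s] add.prems by (auto dest: mset_subset_eqD)
    have K: "finite ?U" "real (card ?U) \<le> 4 * (rho ^ (\<Sum>t\<in>#K. rsize t) - 1)"
      using add.IH add.prems by (auto dest: mset_subset_eq_insertD simp: subset_mset_def)
    have "0 \<le> (rho ^ rsize s - 1) * (rho ^ (\<Sum>t\<in>#K. rsize t) - 1)"
      using rho_ge_1 by (intro mult_nonneg_nonneg) simp_all
    then have "4 * (rho ^ rsize s - 1) + 4 * (rho ^ (\<Sum>t\<in>#K. rsize t) - 1)
      \<le> 4 * (rho ^ (rsize s + (\<Sum>t\<in>#K. rsize t)) - 1)"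
      by (simp add: power_add algebra_simps)
    moreover have "real (card (allsub s \<union> ?U)) \<le> real (card (allsub s)) + real (card ?U)"
      using card_Un_le[of "allsub s" ?U] by linarith
    ultimately show ?case using s K by simp
  qed simp
  define S where "S = (\<Sum>t\<in>#M. rsize t)"
  let ?U = "\<Union> (set_mset (image_mset allsub M))"
  have U: "finite ?U" "real (card ?U) \<le> 4 * (rho ^ S - 1)"
    using *[of M] by (auto simp: S_def)
  have "real (card (rsub (Node M) \<union> ?U)) \<le> real (card (rsub (Node M))) + real (card ?U)"
    using card_Un_le[of "rsub (Node M)" ?U] by linarith
  also have "\<dots> \<le> rho ^ Suc S + 4 * (rho ^ S - 1)"
    using U card_rsub_within_bound[of "Node M"] by (intro add_mono) (auto simp: within_bound_def S_def)
  also have "\<dots> \<le> 4 * (rho ^ Suc S - 1)"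
  proof -
    have "4 * rho ^ S \<le> (3 * rho) * rho ^ S"
      using rho_gt by (intro mult_right_mono) (auto intro: less_imp_le)
    then show ?thesis by simp
  qed
  finally show ?case using U by (simp add: S_def)
qed

section \<open>Isomorphisms of graphs without parallel arcs\<close>

text \<open>
  A digraph isomorphism between pair graphs is determined by its action on vertices, since an arc is
  the pair of its ends.
\<close>
definition vertex_iso :: "('a \<Rightarrow> 'b) \<Rightarrow> 'a pair_pre_digraph \<Rightarrow> 'b pair_pre_digraph \<Rightarrow> bool" where
  "vertex_iso F G H \<longleftrightarrow>
     inj_on F (pverts G) \<and> pverts H = F ` pverts G \<and> parcs H = map_prod F F ` parcs G"

lemma digraph_isomorphism_vertex_iso:
  assumes "pair_wf_digraph G" "vertex_iso F G H"
  shows "\<exists>f. pre_digraph.digraph_isomorphism (with_proj G) f \<and> with_proj H = app_iso f (with_proj G) \<and> iso_verts f = F"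
proof -
  interpret pair_wf_digraph G by fact
  let ?f = "\<lparr>iso_verts = F, iso_arcs = map_prod F F, iso_head = snd, iso_tail = fst\<rparr>"
  have "parcs G \<subseteq> pverts G \<times> pverts G" by (auto dest: in_arcsD1 in_arcsD2)
  then have "inj_on (map_prod F F) (parcs G)"
    using assms(2) by (auto simp: vertex_iso_def intro: inj_on_subset[OF map_prod_inj_on])
  then have "pre_digraph.digraph_isomorphism (with_proj G) ?f"
    using assms(2) wf_digraph_wp_iff[of G] pair_wf_digraph_axioms
    by (auto simp: pre_digraph.digraph_isomorphism_def vertex_iso_def)
  moreover have "with_proj H = app_iso ?f (with_proj G)"
    using assms(2) by (auto simp: with_proj_def app_iso_def vertex_iso_def)
  ultimately show ?thesis by (intro exI[of _ ?f]) auto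
qed

lemma vertex_iso_digraph_isomorphism:
  assumes "pre_digraph.digraph_isomorphism (with_proj G) f" "with_proj H = app_iso f (with_proj G)"
  shows "vertex_iso (iso_verts f) G H"
proof -
  have ht: "iso_tail f = fst" "iso_head f = snd"
    using assms(2) by (auto simp: with_proj_def app_iso_def)
  have arcs: "iso_arcs f a = map_prod (iso_verts f) (iso_verts f) a" if "a \<in> parcs G" for a
    using assms(1) that ht by (auto simp: pre_digraph.digraph_isomorphism_def prod_eq_iff)
  show ?thesis using assms arcs
    by (auto simp: vertex_iso_def pre_digraph.digraph_isomorphism_def with_proj_def app_iso_def image_iff)
qed

lemma digraph_iso_iff:
  "pair_wf_digraph G \<Longrightarrow> digraph_iso (with_proj G) (with_proj H) \<longleftrightarrow> (\<exists>F. vertex_iso F G H)"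
  unfolding digraph_iso_def
  using digraph_isomorphism_vertex_iso vertex_iso_digraph_isomorphism by blast

lemma rooted_iso_iff:
  "pair_wf_digraph G \<Longrightarrow> rooted_iso G r H s \<longleftrightarrow> (\<exists>F. vertex_iso F G H \<and> F r = s)"
  unfolding rooted_iso_def
  using digraph_isomorphism_vertex_iso vertex_iso_digraph_isomorphism by blast

lemma vertex_iso_sym:
  assumes "pair_wf_digraph G" "vertex_iso F G H"
  shows "vertex_iso (the_inv_into (pverts G) F) H G"
proof -
  interpret pair_wf_digraph G by fact
  let ?F = "the_inv_into (pverts G) F"
  have inv: "?F (F v) = v" if "v \<in> pverts G" for v
    using assms(2) that by (auto simp: vertex_iso_def the_inv_into_f_f)
  have "map_prod ?F ?F (map_prod F F a) = a" if "a \<in> parcs G" for a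
    using that inv by (cases a) (auto dest: in_arcsD1 in_arcsD2)
  then have "map_prod ?F ?F ` map_prod F F ` parcs G = parcs G"
    by (force simp: image_image)
  moreover have "?F ` F ` pverts G = pverts G"
    using inv by (force simp: image_image)
  ultimately show ?thesis using assms(2)
    by (auto simp: vertex_iso_def intro: inj_on_the_inv_into)
qed

lemma vertex_iso_trans:
  "vertex_iso F G H \<Longrightarrow> vertex_iso F' H K \<Longrightarrow> vertex_iso (F' \<circ> F) G K"
  by (auto simp: vertex_iso_def image_comp map_prod.comp intro: comp_inj_on)

lemma card_quotient_le:
  assumes "equiv A R" "finite (f ` A)" "\<And>x y. x \<in> A \<Longrightarrow> y \<in> A \<Longrightarrow> f x = f y \<Longrightarrow> (x, y) \<in> R"
  shows "finite (A // R)" "card (A // R) \<le> card (f ` A)"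
proof -
  let ?g = "\<lambda>c. R `` {SOME x. x \<in> A \<and> f x = c}"
  have "A // R \<subseteq> ?g ` (f ` A)"
  proof
    fix X assume "X \<in> A // R"
    then obtain x where x: "x \<in> A" "X = R `` {x}" by (auto elim: quotientE)
    define y where "y = (SOME y. y \<in> A \<and> f y = f x)"
    have "y \<in> A \<and> f y = f x" unfolding y_def by (rule someI[of _ x]) (use x in auto)
    then have "X = ?g (f x)" using assms(1,3) x unfolding y_def[symmetric]
      by (metis equiv_class_eq)
    then show "X \<in> ?g ` (f ` A)" using x by blast
  qed
  then show "finite (A // R)" "card (A // R) \<le> card (f ` A)"
    using assms(2) by (auto intro: finite_surj surj_card_le)
qed

lemma card_quotient_ge:
  assumes "finite (A // R)" "equiv A R" "g ` B \<subseteq> A" "\<And>x y. x \<in> B \<Longrightarrow> y \<in> B \<Longrightarrow> (g x, g y) \<in> R \<Longrightarrow> x = y"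
  shows "card B \<le> card (A // R)"
proof (rule card_inj_on_le[OF _ _ assms(1)])
  show "inj_on (\<lambda>x. R `` {g x}) B"
  proof (rule inj_onI)
    fix x y assume xy: "x \<in> B" "y \<in> B" "R `` {g x} = R `` {g y}"
    then have "(g x, g y) \<in> R" using assms(3) by (intro eq_equiv_class[OF xy(3) assms(2)]) blast
    then show "x = y" using assms(4) xy by blast
  qed
  show "(\<lambda>x. R `` {g x}) ` B \<subseteq> A // R"
    using assms(3) by (auto intro: quotientI)
qed

section \<open>Parent functions of undirected trees\<close>

text \<open>
  An undirected tree with root \<^term>\<open>r\<close>, given by a parent function and a rank that increases by one
  from parent to child. The rank of the root is arbitrary so that a subtree can keep the rank of the whole tree.
\<close>
definition parent_structure :: "'a pair_pre_digraph \<Rightarrow> 'a \<Rightarrow> ('a \<Rightarrow> 'a) \<Rightarrow> ('a \<Rightarrow> nat) \<Rightarrow> bool" where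
  "parent_structure G r par dep \<longleftrightarrow> r \<in> pverts G \<and>
     (\<forall>v\<in>pverts G - {r}. par v \<in> pverts G \<and> dep v = Suc (dep (par v))) \<and>
     parcs G = (\<Union>v\<in>pverts G - {r}. {(v, par v), (par v, v)})"

lemma parent_structureD:
  assumes "parent_structure G r par dep"
  shows "r \<in> pverts G"
    and "v \<in> pverts G \<Longrightarrow> v \<noteq> r \<Longrightarrow> par v \<in> pverts G \<and> dep v = Suc (dep (par v))"
    and "parcs G = (\<Union>v\<in>pverts G - {r}. {(v, par v), (par v, v)})"
  using assms unfolding parent_structure_def by (simp_all only: Diff_iff singleton_iff simp_thms Ball_def)

lemma connected_pair_graph:
  assumes "pair_graph G"
  shows "Digraph_Component.connected (with_proj G) \<longleftrightarrow>
    pverts G \<noteq> {} \<and> (\<forall>u\<in>pverts G. \<forall>v\<in>pverts G. (u, v) \<in> (parcs G)\<^sup>*)"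
proof -
  interpret pair_graph G by fact
  have "symcl (parcs G) = parcs G" using arcs_symmetric by (auto simp: symcl_def)
  then show ?thesis
    unfolding connected_conv with_proj_simps
    using reachable_conv unfolding reachable_def by auto
qed

text \<open>
  If an arc joins two vertices that are already connected without it, then a path connecting them has
  length at least two and closes up to a cycle of length at least three.
\<close>
lemma cycle_from_extra_arc:
  assumes G: "pair_graph G" and H: "pair_pseudo_graph H" and sub: "pverts H \<subseteq> pverts G" "parcs H \<subseteq> parcs G"
      and uv: "(u, v) \<in> parcs G" "(u, v) \<notin> parcs H" and reach: "u \<in> pverts H" "(u, v) \<in> (parcs H)\<^sup>*"
  shows "\<exists>p. pre_digraph.cycle (with_proj G) p \<and> 3 \<le> length p"
proof -
  interpret G: pair_graph G by fact
  interpret H: pair_pseudo_graph H by fact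
  have "u \<rightarrow>\<^sup>*\<^bsub>with_proj H\<^esub> v" using reach H.reachable_conv'[of u v] by simp
  then obtain p where p: "H.apath u p v" using H.reachable_apath by blast
  have "subgraph (with_proj H) (with_proj G)"
    using sub by (auto intro!: subgraphI H.wf_digraph G.wf_digraph)
  then have pG: "G.apath u p v" using G.subgraph_apath_imp_apath p by blast
  have "u \<noteq> v" using uv(1) G.no_loops' by blast
  then have "p \<noteq> []" using p by (auto simp: H.apath_Nil_iff)
  have "length p \<noteq> 1"
  proof
    assume "length p = 1"
    then obtain e where "p = [e]" by (auto simp: length_Suc_conv)
    then have "e = (u, v)" "e \<in> parcs H" using p by (auto simp: H.apath_simps prod_eq_iff)
    then show False using uv(2) by simp
  qed
  with \<open>p \<noteq> []\<close> have "2 \<le> length p" by (cases p) (auto simp: Suc_le_eq)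
  have aw: "G.awalk u p v" "distinct (pawalk_verts u p)" using pG by (auto simp: G.apath_def)
  have "(v, u) \<in> parcs G" using uv(1) G.arcs_symmetric by blast
  then have "G.awalk v [(v, u)] u" by (auto simp: G.awalk_simps dest: G.in_arcsD2)
  then have aw': "G.awalk u (p @ [(v, u)]) u" using aw(1) G.awalk_appendI by blast
  have "pawalk_verts u (p @ [(v, u)]) = pawalk_verts u p @ [u]"
    using G.awalk_verts_append[OF aw'] G.awlast_of_awalk[OF aw(1)] by simp
  moreover obtain q where q: "pawalk_verts u p = u # q"
    using \<open>p \<noteq> []\<close> aw(1) by (cases p) (auto simp: G.awalk_Cons_iff)
  ultimately have "distinct (tl (pawalk_verts u (p @ [(v, u)])))"
    using aw(2) by simp
  then have "G.cycle (p @ [(v, u)])" using aw' by (auto simp: G.cycle_def)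
  then show ?thesis using \<open>2 \<le> length p\<close> by (intro exI[of _ "p @ [(v, u)]"]) auto
qed

text \<open>
  The parent of \<^term>\<open>v\<close> is a neighbour one step closer to the root. The arcs between vertices and their
  parents connect everything, so any other arc would close a cycle.
\<close>
lemma undirected_tree_parents:
  assumes T: "undirected_tree G" and r: "r \<in> pverts G"
  obtains par dep where "parent_structure G r par dep"
proof -
  have G: "pair_graph G" and nocyc: "\<not> (\<exists>p. pre_digraph.cycle (with_proj G) p \<and> 3 \<le> length p)"
    and conn: "\<And>u v. u \<in> pverts G \<Longrightarrow> v \<in> pverts G \<Longrightarrow> (u, v) \<in> (parcs G)\<^sup>*"
    using T connected_pair_graph by (auto simp: undirected_tree_def)
  interpret G: pair_graph G by fact
  define dep where "dep v = (LEAST n. (v, r) \<in> parcs G ^^ n)" for v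
  have dep: "(v, r) \<in> parcs G ^^ dep v" if "v \<in> pverts G" for v
    using conn[OF that r] unfolding dep_def by (metis LeastI rtrancl_power)
  have step: "\<exists>u. (v, u) \<in> parcs G \<and> dep v = Suc (dep u)" if v: "v \<in> pverts G" "v \<noteq> r" for v
  proof -
    obtain m where m: "dep v = Suc m" using dep[OF v(1)] v(2) by (cases "dep v") auto
    then obtain u where u: "(v, u) \<in> parcs G" "(u, r) \<in> parcs G ^^ m"
      using dep[OF v(1)] by (metis relpow_Suc_D2)
    then have le: "dep u \<le> m" unfolding dep_def by (intro Least_le)
    have "u \<in> pverts G" using u by (auto dest: G.in_arcsD2)
    then have "(v, r) \<in> parcs G ^^ Suc (dep u)" using u dep by (metis relpow_Suc_I2)
    then have "dep v \<le> Suc (dep u)" unfolding dep_def[of v] by (intro Least_le)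
    then show ?thesis using u le m by auto
  qed
  define par where "par v = (SOME u. (v, u) \<in> parcs G \<and> dep v = Suc (dep u))" for v
  have par: "(v, par v) \<in> parcs G" "dep v = Suc (dep (par v))" if "v \<in> pverts G" "v \<noteq> r" for v
    using someI_ex[OF step[OF that]] unfolding par_def by auto
  define H where "H = \<lparr>pverts = pverts G, parcs = (\<Union>v\<in>pverts G - {r}. {(v, par v), (par v, v)})\<rparr>"
  have sub: "parcs H \<subseteq> parcs G" using par G.arcs_symmetric by (auto simp: H_def)
  have H: "pair_pseudo_graph H"
  proof
    show "fst e \<in> pverts H" "snd e \<in> pverts H" if "e \<in> parcs H" for e
      using that sub G.in_arcsD1 G.in_arcsD2 by (cases e; auto simp: H_def)+
    show "finite (pverts H)" "finite (parcs H)" using G.pair_finite_verts by (auto simp: H_def)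
    show "symmetric (with_proj H)" unfolding symmetric_def by (auto simp: sym_def H_def)
  qed
  have reach: "(v, r) \<in> (parcs H)\<^sup>*" if "v \<in> pverts G" for v
    using that
  proof (induction "dep v" arbitrary: v)
    case 0
    then show ?case using par(2)[of v] by (cases "v = r") auto
  next
    case (Suc n)
    show ?case
    proof (cases "v = r")
      case False
      then have "(v, par v) \<in> parcs H" using Suc.prems by (auto simp: H_def)
      moreover have "(par v, r) \<in> (parcs H)\<^sup>*"
        using Suc False par[of v] by (auto dest: G.in_arcsD2)
      ultimately show ?thesis by (rule converse_rtrancl_into_rtrancl)
    qed simp
  qed
  have symH: "sym (parcs H)" by (auto simp: sym_def H_def)
  have "parcs G \<subseteq> parcs H"
  proof
    fix e assume e: "e \<in> parcs G"
    obtain u v where uv: "e = (u, v)" by (cases e)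
    have V: "u \<in> pverts G" "v \<in> pverts G" using e uv by (auto dest: G.in_arcsD1 G.in_arcsD2)
    have "(u, v) \<in> (parcs H)\<^sup>*"
      using reach[OF V(1)] reach[OF V(2)] symH by (meson rtrancl_trans sym_rtrancl symD)
    then show "e \<in> parcs H"
      using cycle_from_extra_arc[OF G H _ sub, of u v] e V nocyc uv by (auto simp: H_def)
  qed
  then have "parent_structure G r par dep"
    using sub par r by (auto simp: parent_structure_def H_def dest: G.in_arcsD2)
  then show ?thesis using that by blast
qed

lemma subtree_undirected_tree:
  assumes "undirected_tree T" "H \<in> subtrees T"
  shows "undirected_tree H"
proof -
  interpret pair_graph T using assms by (simp add: undirected_tree_def)
  show ?thesis using assms subgraph_cycle by (auto simp: undirected_tree_def subtrees_def)
qed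

text \<open>
  The subtree is a tree itself; root it at its vertex of least rank. Its own parent function agrees with
  the given one, by induction on the distance from that vertex: otherwise the path to it would have to
  turn upwards after going downwards, i.e. return along the same arc.
\<close>
lemma subtree_parents:
  assumes T: "undirected_tree T" and P: "parent_structure T r par dep" and H: "H \<in> subtrees T"
  obtains top where "parent_structure H top par dep" "r \<in> pverts H \<Longrightarrow> top = r"
proof -
  have Ht: "undirected_tree H" using T H by (rule subtree_undirected_tree)
  have sub: "pverts H \<subseteq> pverts T" "parcs H \<subseteq> parcs T"
    using H by (auto simp: subtrees_def subgraph_def)
  have "pverts H \<noteq> {}"
    using Ht connected_pair_graph by (auto simp: undirected_tree_def)
  then obtain top where top: "top \<in> pverts H" "\<And>v. v \<in> pverts H \<Longrightarrow> dep top \<le> dep v"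
    using ex_has_least_nat[of "\<lambda>v. v \<in> pverts H" _ dep] by blast
  obtain par' dep' where P': "parent_structure H top par' dep'"
    using undirected_tree_parents[OF Ht top(1)] by blast
  have eq: "w \<noteq> r \<and> par' w = par w" if "w \<in> pverts H - {top}" for w
    using that
  proof (induction "dep' w" arbitrary: w rule: less_induct)
    case less
    define u where "u = par' w"
    have u: "u \<in> pverts H" "dep' w = Suc (dep' u)" using P' less.prems by (auto simp: parent_structure_def u_def)
    have "(w, u) \<in> parcs T" using P' less.prems sub by (auto simp: parent_structure_def u_def)
    then consider "w \<noteq> r" "u = par w" | "u \<in> pverts T - {r}" "w = par u"
      using P by (auto simp: parent_structure_def)
    then show ?case
    proof cases
      case 2
      then have "dep u = Suc (dep w)" using P by (auto simp: parent_structure_def)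
      then have "u \<noteq> top" using top(2)[of w] less.prems by auto
      then have "par' u = w" using less.hyps[of u] u 2 by auto
      then have "dep' u = Suc (dep' w)" using P' u \<open>u \<noteq> top\<close> by (auto simp: parent_structure_def)
      then show ?thesis using u by simp
    qed (simp add: u_def)
  qed
  have "parent_structure H top par dep"
    unfolding parent_structure_def
  proof (intro conjI ballI)
    show "top \<in> pverts H" by fact
    show "parcs H = (\<Union>v\<in>pverts H - {top}. {(v, par v), (par v, v)})"
      using P' eq by (auto simp: parent_structure_def)
    fix v assume v: "v \<in> pverts H - {top}"
    then have "par' v \<in> pverts H" using P' by (auto simp: parent_structure_def)
    then show "par v \<in> pverts H" using eq[OF v] by simp
    show "dep v = Suc (dep (par v))" using P eq[of v] v sub by (auto simp: parent_structure_def)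
  qed
  moreover have "top = r" if "r \<in> pverts H"
    using eq[of r] that by auto
  ultimately show ?thesis using that by blast
qed

section \<open>Codes of subtrees\<close>
lemma image_mset_in_forests:
  assumes "finite B" "A \<subseteq> B" "\<And>a. a \<in> A \<Longrightarrow> f a \<in> rsub (g a)"
  shows "image_mset f (mset_set A) \<in> forests (image_mset g (mset_set B))"
  using assms
proof (induction B arbitrary: A)
  case (insert b B)
  have IH: "image_mset f (mset_set (A - {b})) \<in> forests (image_mset g (mset_set B))"
    using insert by (intro insert.IH) auto
  define w where "w = (if b \<in> A then {#f b#} else {#})"
  have "w \<in> choices (rsub (g b))" using insert.prems by (auto simp: w_def choices_def)
  then have "w + image_mset f (mset_set (A - {b})) \<in> choices (rsub (g b)) + forests (image_mset g (mset_set B))"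
    using IH by (rule set_plus_intro)
  moreover have "w + image_mset f (mset_set (A - {b})) = image_mset f (mset_set A)"
  proof (cases "b \<in> A")
    case True
    have "finite A" using insert by (meson finite_insert finite_subset)
    then have "mset_set A = add_mset b (mset_set (A - {b}))" using True by (simp add: mset_set.remove)
    then show ?thesis using True by (simp add: w_def)
  qed (simp add: w_def)
  ultimately show ?case using insert by simp
qed simp

lemma image_mset_eq_bij_betw:
  assumes "finite A" "finite B" "image_mset f (mset_set A) = image_mset g (mset_set B)"
  shows "\<exists>\<beta>. bij_betw \<beta> A B \<and> (\<forall>a\<in>A. f a = g (\<beta> a))"
  using assms
proof (induction A arbitrary: B)
  case empty
  then show ?case by (auto simp: mset_set_empty_iff bij_betw_def)
next
  case (insert a A)
  have "f a \<in># image_mset g (mset_set B)" using insert.hyps insert.prems(2)[symmetric] by simp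
  then obtain b where b: "b \<in> B" "g b = f a" using insert.prems(1) by auto
  have "mset_set B = add_mset b (mset_set (B - {b}))" using b insert.prems(1) by (simp add: mset_set.remove)
  then have "image_mset f (mset_set A) = image_mset g (mset_set (B - {b}))"
    using insert.hyps insert.prems(2) b by simp
  then obtain \<beta> where \<beta>: "bij_betw \<beta> A (B - {b})" "\<forall>a\<in>A. f a = g (\<beta> a)"
    using insert.IH[of "B - {b}"] insert.prems(1) by auto
  have "bij_betw (\<beta>(a := b)) A (B - {b})"
    using \<beta>(1) insert.hyps(2) by (subst bij_betw_cong[of A _ \<beta>]) auto
  then have "bij_betw (\<beta>(a := b)) (insert a A) (insert b (B - {b}))"
    using notIn_Un_bij_betw[of a A "\<beta>(a := b)" "B - {b}"] insert.hyps(2) by simp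
  moreover have "insert b (B - {b}) = B" using b(1) by blast
  moreover have "\<forall>x\<in>insert a A. f x = g ((\<beta>(a := b)) x)" using b(2) \<beta>(2) by simp
  ultimately show ?case by metis
qed

text \<open>
  A tree with a fixed root and parent function. Subtrees are represented by their vertex sets.
\<close>
locale layered_tree =
  fixes T :: "'a pair_pre_digraph" and r :: 'a and par :: "'a \<Rightarrow> 'a" and dep :: "'a \<Rightarrow> nat"
  assumes tree: "undirected_tree T" and parent_structure: "parent_structure T r par dep"
begin

abbreviation "V \<equiv> pverts T"

definition kids :: "'a set \<Rightarrow> 'a \<Rightarrow> 'a set" where
  "kids S v = {c \<in> S. c \<noteq> r \<and> par c = v}"

text \<open>
  The recursion for codes goes away from the root, with the distance to the lowest level as fuel.
\<close>
definition height :: nat where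
  "height = Max (dep ` V)"

primrec code_fuel :: "nat \<Rightarrow> 'a set \<Rightarrow> 'a \<Rightarrow> rtree" where
  "code_fuel 0 S v = leaf"
| "code_fuel (Suc n) S v = Node (image_mset (code_fuel n S) (mset_set (kids S v)))"

definition code :: "'a set \<Rightarrow> 'a \<Rightarrow> rtree" where
  "code S v = code_fuel (height - dep v) S v"

lemma finite_V: "finite V"
  using tree by (auto simp: undirected_tree_def pair_graph_def pair_digraph_def pair_fin_digraph_def
      pair_fin_digraph_axioms_def)

lemma finite_subset_V: "S \<subseteq> V \<Longrightarrow> finite S"
  using finite_V finite_subset by blast

lemma finite_kids: "S \<subseteq> V \<Longrightarrow> finite (kids S v)"
  by (rule finite_subset_V) (auto simp: kids_def)

lemma dep_le_height: "v \<in> V \<Longrightarrow> dep v \<le> height"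
  unfolding height_def using finite_V by (intro Max_ge) auto

lemma root_in_V: "r \<in> V"
  using parent_structure by (simp add: parent_structure_def)

lemma par_V: "v \<in> V \<Longrightarrow> v \<noteq> r \<Longrightarrow> par v \<in> V" "v \<in> V \<Longrightarrow> v \<noteq> r \<Longrightarrow> dep v = Suc (dep (par v))"
  using parent_structure by (auto simp: parent_structure_def)

lemma kids_V: "S \<subseteq> V \<Longrightarrow> c \<in> kids S v \<Longrightarrow> c \<in> S \<and> c \<in> V \<and> dep c = Suc (dep v)"
  using par_V by (auto simp: kids_def)

lemma code_rec:
  assumes "S \<subseteq> V" "v \<in> V"
  shows "code S v = Node (image_mset (code S) (mset_set (kids S v)))"
proof (cases "height - dep v")
  case 0
  then have "kids S v = {}"
    using kids_V[OF assms(1)] dep_le_height by (metis Suc_n_not_le_n diff_is_0_eq ex_in_conv le_trans)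
  then show ?thesis using 0 by (simp add: code_def)
next
  case (Suc n)
  have "image_mset (code_fuel n S) (mset_set (kids S v)) = image_mset (code S) (mset_set (kids S v))"
  proof (rule image_mset_cong)
    fix c assume "c \<in># mset_set (kids S v)"
    then have "dep c = Suc (dep v)" using kids_V finite_kids assms by auto
    then have "height - dep c = n" using Suc by simp
    then show "code_fuel n S c = code S c" by (simp add: code_def)
  qed
  then show ?thesis using Suc by (simp add: code_def)
qed

lemma down_induct [consumes 1, case_names step]:
  assumes "v \<in> V" "\<And>v. v \<in> V \<Longrightarrow> (\<And>c. c \<in> V \<Longrightarrow> dep c = Suc (dep v) \<Longrightarrow> P c) \<Longrightarrow> P v"
  shows "P v"
  using assms(1)
proof (induction "height - dep v" arbitrary: v rule: less_induct)
  case less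
  show ?case
  proof (rule assms(2)[OF less.prems])
    fix c assume "c \<in> V" "dep c = Suc (dep v)"
    then show "P c" using less dep_le_height[of c] by auto
  qed
qed

text \<open>
  Restricting to fewer vertices only deletes children, so the code of a subtree is one of the shapes
  counted by \<^const>\<open>rsub\<close>.
\<close>
lemma code_in_rsub:
  assumes "S \<subseteq> V" "v \<in> V"
  shows "code S v \<in> rsub (code V v)"
  using assms(2)
proof (induction v rule: down_induct)
  case (step v)
  have "image_mset (code S) (mset_set (kids S v)) \<in> forests (image_mset (code V) (mset_set (kids V v)))"
  proof (rule image_mset_in_forests)
    show "finite (kids V v)" by (rule finite_kids) simp
    show "kids S v \<subseteq> kids V v" using assms(1) by (auto simp: kids_def)
    show "code S a \<in> rsub (code V a)" if "a \<in> kids S v" for a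
      using step that kids_V[OF assms(1)] by blast
  qed
  then show ?case using assms(1) step.hyps by (simp add: code_rec rsub_Node)
qed

lemma allsub_code_mono:
  assumes "v \<in> V"
  shows "allsub (code V v) \<subseteq> allsub (code V r)"
  using assms
proof (induction "dep v" arbitrary: v rule: less_induct)
  case less
  show ?case
  proof (cases "v = r")
    case False
    have p: "par v \<in> V" "dep v = Suc (dep (par v))" using par_V less.prems False by auto
    have "v \<in> kids V (par v)" using less.prems False by (auto simp: kids_def)
    then have "allsub (code V v) \<subseteq> allsub (code V (par v))"
      unfolding code_rec[OF order_refl p(1)] using finite_kids[of V "par v"] by (intro allsub_branch) auto
    also have "\<dots> \<subseteq> allsub (code V r)" using less.hyps p by simp
    finally show ?thesis .
  qed simp
qed

lemma dep_root_le: "v \<in> V \<Longrightarrow> dep r \<le> dep v \<and> (dep v = dep r \<longrightarrow> v = r)"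
proof (induction "dep v" arbitrary: v rule: less_induct)
  case less
  then show ?case using par_V[of v] by (cases "v = r") fastforce+
qed

text \<open>
  Summing the sizes of the codes over one level counts the vertices on this level and below.
\<close>
lemma rsize_code: "rsize (code V r) = card V"
proof -
  define L where "L d = {v \<in> V. dep v = d}" for d
  have fin: "finite (L d)" for d using finite_V by (simp add: L_def)
  have rsize: "rsize (code V v) = Suc (\<Sum>c\<in>kids V v. rsize (code V c))" if "v \<in> V" for v
    unfolding code_rec[OF order_refl that] using finite_kids[of V v]
    by (simp add: image_mset.compositionality comp_def sum_unfold_sum_mset)
  have kids: "kids V v = {c \<in> L (Suc d). par c = v}" if "v \<in> L d" "dep r \<le> d" for v d
    using that par_V by (auto simp: kids_def L_def)
  have level: "(\<Sum>v\<in>L d. rsize (code V v)) = card {v \<in> V. d \<le> dep v}" if "dep r \<le> d" for d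
    using that
  proof (induction "Suc height - d" arbitrary: d rule: less_induct)
    case less
    show ?case
    proof (cases "d \<le> height")
      case False
      then have "L d = {}" "{v \<in> V. d \<le> dep v} = {}" using dep_le_height by (force simp: L_def)+
      then show ?thesis by (simp only: sum.empty card.empty)
    next
      case True
      have "(\<Sum>v\<in>L d. rsize (code V v)) = (\<Sum>v\<in>L d. 1 + (\<Sum>c\<in>{c \<in> L (Suc d). par c = v}. rsize (code V c)))"
      proof (rule sum.cong[OF refl])
        fix v assume v: "v \<in> L d"
        then have "v \<in> V" by (simp add: L_def)
        then show "rsize (code V v) = 1 + (\<Sum>c\<in>{c \<in> L (Suc d). par c = v}. rsize (code V c))"
          unfolding rsize[OF \<open>v \<in> V\<close>] kids[OF v less.prems] by simp
      qed
      also have "\<dots> = card (L d) + (\<Sum>v\<in>L d. \<Sum>c\<in>{c \<in> L (Suc d). par c = v}. rsize (code V c))"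
        by (subst sum.distrib) simp
      also have "(\<Sum>v\<in>L d. \<Sum>c\<in>{c \<in> L (Suc d). par c = v}. rsize (code V c)) = (\<Sum>c\<in>L (Suc d). rsize (code V c))"
      proof (rule sum.group[OF fin fin])
        show "par ` L (Suc d) \<subseteq> L d" using par_V less.prems by (force simp: L_def)
      qed
      also have "\<dots> = card {v \<in> V. Suc d \<le> dep v}" using True less.prems by (intro less.hyps) auto
      also have "card (L d) + \<dots> = card (L d \<union> {v \<in> V. Suc d \<le> dep v})"
        using finite_V fin by (intro card_Un_disjoint[symmetric]) (auto simp: L_def)
      also have "L d \<union> {v \<in> V. Suc d \<le> dep v} = {v \<in> V. d \<le> dep v}" by (auto simp: L_def)
      finally show ?thesis .
    qed
  qed
  have "L (dep r) = {r}" "{v \<in> V. dep r \<le> dep v} = V"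
    using dep_root_le root_in_V by (auto simp: L_def)
  then show ?thesis using level[of "dep r"] by simp
qed

text \<open>
  Vertices with equal codes have matching multisets of codes of children, hence a code-preserving
  bijection \<open>\<beta>\<close> between their children. Following these bijections from the top downwards defines the
  isomorphism; it is injective and surjective level by level.
\<close>
lemma same_code_vertex_iso:
  assumes H: "parent_structure H v par dep" "pverts H \<subseteq> V" "r \<in> pverts H \<Longrightarrow> v = r"
      and K: "parent_structure K w par dep" "pverts K \<subseteq> V" "r \<in> pverts K \<Longrightarrow> w = r"
      and eq: "code (pverts H) v = code (pverts K) w"
  shows "\<exists>F. vertex_iso F H K \<and> F v = w"
proof -
  let ?S = "pverts H" and ?S' = "pverts K"
  have vw: "v \<in> ?S" "w \<in> ?S'" using H K by (auto simp: parent_structure_def)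
  have root: "x \<noteq> r \<and> par x \<in> ?S \<and> dep x = Suc (dep (par x))" if "x \<in> ?S" "x \<noteq> v" for x
    using H that by (auto simp: parent_structure_def)
  have root': "x \<noteq> r \<and> par x \<in> ?S' \<and> dep x = Suc (dep (par x))" if "x \<in> ?S'" "x \<noteq> w" for x
    using K that by (auto simp: parent_structure_def)
  have top: "dep v \<le> dep x \<and> (dep x = dep v \<longrightarrow> x = v)" if "x \<in> ?S" for x
    using that
  proof (induction "dep x" arbitrary: x rule: less_induct)
    case less
    then show ?case using root[of x] by (cases "x = v") fastforce+
  qed
  have top': "dep w \<le> dep x \<and> (dep x = dep w \<longrightarrow> x = w)" if "x \<in> ?S'" for x
    using that
  proof (induction "dep x" arbitrary: x rule: less_induct)
    case less
    then show ?case using root'[of x] by (cases "x = w") fastforce+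
  qed
  have kid: "c \<noteq> v \<and> dep c = Suc (dep x)" if "c \<in> kids ?S x" "x \<in> ?S" for c x
    using that kids_V[OF H(2), of c x] top[of x] by auto
  have kid': "c \<noteq> w \<and> dep c = Suc (dep x)" if "c \<in> kids ?S' x" "x \<in> ?S'" for c x
    using that kids_V[OF K(2), of c x] top'[of x] by auto
  define \<beta> where "\<beta> x y = (SOME b. bij_betw b (kids ?S x) (kids ?S' y) \<and>
      (\<forall>c\<in>kids ?S x. code ?S c = code ?S' (b c)))" for x y
  have \<beta>: "bij_betw (\<beta> x y) (kids ?S x) (kids ?S' y)"
          "\<And>c. c \<in> kids ?S x \<Longrightarrow> code ?S c = code ?S' (\<beta> x y c)"
    if "x \<in> ?S" "y \<in> ?S'" "code ?S x = code ?S' y" for x y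
  proof -
    have xy: "x \<in> V" "y \<in> V" using that H(2) K(2) by auto
    have "image_mset (code ?S) (mset_set (kids ?S x)) = image_mset (code ?S') (mset_set (kids ?S' y))"
      using that(3) unfolding code_rec[OF H(2) xy(1)] code_rec[OF K(2) xy(2)] by simp
    then have "\<exists>b. bij_betw b (kids ?S x) (kids ?S' y) \<and> (\<forall>c\<in>kids ?S x. code ?S c = code ?S' (b c))"
      using H(2) K(2) by (intro image_mset_eq_bij_betw finite_kids)
    then have "bij_betw (\<beta> x y) (kids ?S x) (kids ?S' y) \<and> (\<forall>c\<in>kids ?S x. code ?S c = code ?S' (\<beta> x y c))"
      unfolding \<beta>_def by (rule someI_ex)
    then show "bij_betw (\<beta> x y) (kids ?S x) (kids ?S' y)"
      "\<And>c. c \<in> kids ?S x \<Longrightarrow> code ?S c = code ?S' (\<beta> x y c)"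
      by blast+
  qed
  define Fn where "Fn = rec_nat (\<lambda>u. w) (\<lambda>n f u. \<beta> (par u) (f (par u)) u)"
  define F where "F u = Fn (dep u - dep v) u" for u
  have F_v: "F v = w" by (simp add: F_def Fn_def)
  have F_rec: "F u = \<beta> (par u) (F (par u)) u" if "u \<in> ?S" "u \<noteq> v" for u
  proof -
    have "dep u - dep v = Suc (dep (par u) - dep v)" using root[OF that] top[of "par u"] by auto
    then show ?thesis by (simp add: F_def Fn_def)
  qed
  have kidI: "u \<in> kids ?S (par u)" if "u \<in> ?S" "u \<noteq> v" for u
    using root[OF that] that by (auto simp: kids_def)
  have main: "F u \<in> ?S' \<and> code ?S u = code ?S' (F u) \<and> dep (F u) + dep v = dep u + dep w \<and>
      (u \<noteq> v \<longrightarrow> F u \<noteq> w \<and> par (F u) = F (par u))" if "u \<in> ?S" for u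
    using that
  proof (induction "dep u" arbitrary: u rule: less_induct)
    case less
    show ?case
    proof (cases "u = v")
      case True
      then show ?thesis using F_v vw eq by simp
    next
      case False
      have p: "par u \<in> ?S" "dep u = Suc (dep (par u))" using root less.prems False by auto
      have IH: "F (par u) \<in> ?S'" "code ?S (par u) = code ?S' (F (par u))" "dep (F (par u)) + dep v = dep (par u) + dep w"
        using less.hyps[of "par u"] p by auto
      have "F u \<in> kids ?S' (F (par u))" "code ?S u = code ?S' (F u)"
        unfolding F_rec[OF less.prems False] using \<beta>[OF p(1) IH(1,2)] kidI[OF less.prems False]
        by (auto dest: bij_betwE)
      then show ?thesis using kid'[of "F u"] IH p by (auto simp: kids_def)
    qed
  qed
  have inj: "inj_on F ?S"
  proof -
    have "x = y" if "x \<in> ?S" "y \<in> ?S" "F x = F y" for x y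
      using that
    proof (induction "dep x" arbitrary: x y rule: less_induct)
      case less
      have d: "dep x = dep y" using main[of x] main[of y] less.prems by simp
      show ?case
      proof (cases "x = v")
        case True
        then show ?thesis using d top[of y] less.prems by auto
      next
        case False
        then have "y \<noteq> v" using d top[of x] less.prems by auto
        have p: "par x \<in> ?S" "dep x = Suc (dep (par x))" "par y \<in> ?S" 
          using root less.prems False \<open>y \<noteq> v\<close> by auto
        have "F (par x) = F (par y)" using main[of x] main[of y] less.prems False \<open>y \<noteq> v\<close> by metis
        then have e: "par x = par y" using less.hyps[of "par x" "par y"] p by simp
        have "inj_on (\<beta> (par x) (F (par x))) (kids ?S (par x))"
          using \<beta>(1)[of "par x" "F (par x)"] main[of "par x"] p by (auto dest: bij_betw_imp_inj_on)
        moreover have "\<beta> (par x) (F (par x)) x = \<beta> (par x) (F (par x)) y"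
          using F_rec[of x] F_rec[of y] less.prems False \<open>y \<noteq> v\<close> e by simp
        ultimately show ?thesis
          using kidI[of x] kidI[of y] less.prems False \<open>y \<noteq> v\<close> e by (auto dest: inj_onD)
      qed
    qed
    then show ?thesis by (auto intro: inj_onI)
  qed
  have surj: "y \<in> F ` ?S" if "y \<in> ?S'" for y
    using that
  proof (induction "dep y" arbitrary: y rule: less_induct)
    case less
    show ?case
    proof (cases "y = w")
      case True
      then show ?thesis using F_v vw by blast
    next
      case False
      have p: "par y \<in> ?S'" "dep y = Suc (dep (par y))" "y \<noteq> r" using root' less.prems False by auto
      then obtain x where x: "x \<in> ?S" "par y = F x" using less.hyps[of "par y"] by auto
      have "y \<in> kids ?S' (F x)" using less.prems p x by (auto simp: kids_def)
      then have "y \<in> \<beta> x (F x) ` kids ?S x"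
        using \<beta>(1)[of x "F x"] main[of x] x(1) by (auto simp: bij_betw_def)
      then obtain c where c: "c \<in> kids ?S x" "y = \<beta> x (F x) c" by auto
      then have "F c = y" using F_rec[of c] kid[of c x] x(1) by (auto simp: kids_def)
      moreover have "c \<in> ?S" using c(1) by (simp add: kids_def)
      ultimately show ?thesis by blast
    qed
  qed
  have img: "?S' = F ` ?S" using main surj by auto
  have "parcs K = map_prod F F ` parcs H"
  proof -
    have arcs: "parcs H = (\<Union>x\<in>?S - {v}. {(x, par x), (par x, x)})"
      "parcs K = (\<Union>y\<in>?S' - {w}. {(y, par y), (par y, y)})"
      by (rule parent_structureD(3)[OF H(1)], rule parent_structureD(3)[OF K(1)])
    have "?S' - {w} = F ` (?S - {v})" using img inj F_v vw by (auto dest: inj_onD)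
    then have "parcs K = (\<Union>x\<in>?S - {v}. {(F x, par (F x)), (par (F x), F x)})"
      unfolding arcs(2) by (simp only: UN_simps)
    also have "\<dots> = (\<Union>x\<in>?S - {v}. map_prod F F ` {(x, par x), (par x, x)})"
      using main by (intro SUP_cong) auto
    also have "\<dots> = map_prod F F ` parcs H"
      unfolding arcs(1) by (simp only: image_UN)
    finally show ?thesis .
  qed
  then show ?thesis using inj img F_v by (intro exI[of _ F]) (auto simp: vertex_iso_def)
qed

end

section \<open>Upper bounds for the numbers of isomorphism classes\<close>
lemma subtree_wf: "H \<in> subtrees T \<Longrightarrow> pair_wf_digraph H"
  by (auto simp: subtrees_def pair_graph_def pair_digraph_def pair_fin_digraph_def)

lemma equiv_restricted_relation:
  assumes "\<And>x. x \<in> A \<Longrightarrow> P x x"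
      and "\<And>x y. x \<in> A \<Longrightarrow> y \<in> A \<Longrightarrow> P x y \<Longrightarrow> P y x"
      and "\<And>x y z. x \<in> A \<Longrightarrow> y \<in> A \<Longrightarrow> z \<in> A \<Longrightarrow> P x y \<Longrightarrow> P y z \<Longrightarrow> P x z"
  shows "equiv A {(x, y). x \<in> A \<and> y \<in> A \<and> P x y}"
proof (rule equivI)
  show "refl_on A {(x, y). x \<in> A \<and> y \<in> A \<and> P x y}" using assms(1) by (auto intro!: refl_onI)
  show "sym {(x, y). x \<in> A \<and> y \<in> A \<and> P x y}" using assms(2) by (auto intro!: symI)
  show "trans {(x, y). x \<in> A \<and> y \<in> A \<and> P x y}" by (rule transI) (use assms(3) in blast)
qed auto

lemma vertex_iso_refl: "vertex_iso id H H"
  by (simp add: vertex_iso_def prod.map_id0)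

lemma equiv_subtree_iso:
  "equiv (subtrees T) {(H, K). H \<in> subtrees T \<and> K \<in> subtrees T \<and> digraph_iso (with_proj H) (with_proj K)}"
proof (rule equiv_restricted_relation)
  fix H assume H: "H \<in> subtrees T"
  have wf: "wf_digraph (with_proj H)" using subtree_wf[OF H] by (simp add: wf_digraph_wp_iff)
  show "digraph_iso (with_proj H) (with_proj H)"
    unfolding digraph_iso_iff[OF subtree_wf[OF H]] by (rule exI) (rule vertex_iso_refl)
  fix K assume HK: "digraph_iso (with_proj H) (with_proj K)"
  show "digraph_iso (with_proj K) (with_proj H)"
    by (rule digraph_iso_swap[OF wf HK])
  fix L assume "digraph_iso (with_proj K) (with_proj L)"
  with HK show "digraph_iso (with_proj H) (with_proj L)"
    by (rule digraph_iso_trans)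
qed

lemma equiv_rooted_subtree_iso:
  "equiv (rooted_subtrees T r) {(H, K). H \<in> rooted_subtrees T r \<and> K \<in> rooted_subtrees T r \<and> rooted_iso H r K r}"
proof (rule equiv_restricted_relation)
  have wf: "pair_wf_digraph H" if "H \<in> rooted_subtrees T r" for H
    using that subtree_wf by (auto simp: rooted_subtrees_def)
  fix H assume H: "H \<in> rooted_subtrees T r"
  note iso = rooted_iso_iff[OF wf[OF H]]
  show "rooted_iso H r H r"
    unfolding iso by (rule exI[of _ id]) (simp add: vertex_iso_refl)
  fix K assume K: "K \<in> rooted_subtrees T r" and HK: "rooted_iso H r K r"
  obtain F where F: "vertex_iso F H K" "F r = r" using HK unfolding iso by (elim exE conjE)
  have "the_inv_into (pverts H) F r = r"
    using F H by (intro the_inv_into_f_eq) (auto simp: vertex_iso_def rooted_subtrees_def)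
  then show "rooted_iso K r H r"
    unfolding rooted_iso_iff[OF wf[OF K]] using vertex_iso_sym[OF wf[OF H] F(1)] by (intro exI[of _ "the_inv_into (pverts H) F"]) simp
  fix L assume KL: "rooted_iso K r L r"
  obtain F' where F': "vertex_iso F' K L" "F' r = r"
    using KL unfolding rooted_iso_iff[OF wf[OF K]] by (elim exE conjE)
  show "rooted_iso H r L r"
    unfolding iso using vertex_iso_trans[OF F(1) F'(1)] F(2) F'(2)
    by (intro exI[of _ "F' \<circ> F"]) simp
qed

theorem nr_le:
  assumes T: "undirected_tree T" and r: "r \<in> pverts T"
  shows "real (nr T r) \<le> rho ^ card (pverts T)"
proof -
  obtain par dep where P: "parent_structure T r par dep" using undirected_tree_parents[OF assms] by blast
  interpret layered_tree T r par dep using T P by unfold_locales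
  let ?A = "rooted_subtrees T r"
  let ?R = "{(H, K). H \<in> ?A \<and> K \<in> ?A \<and> rooted_iso H r K r}"
  let ?f = "\<lambda>H. code (pverts H) r"
  have A: "parent_structure H r par dep" "pverts H \<subseteq> V" if "H \<in> ?A" for H
  proof -
    have H: "H \<in> subtrees T" "r \<in> pverts H" using that by (auto simp: rooted_subtrees_def)
    then show "parent_structure H r par dep" using subtree_parents[OF T P H(1)] by metis
    show "pverts H \<subseteq> V" using H by (auto simp: subtrees_def subgraph_def)
  qed
  have img: "?f ` ?A \<subseteq> rsub (code V r)"
    using code_in_rsub[OF A(2) root_in_V] by (rule image_subsetI)
  have "card (?A // ?R) \<le> card (?f ` ?A)"
  proof (rule card_quotient_le[OF equiv_rooted_subtree_iso])
    show "finite (?f ` ?A)" using img finite_rsub finite_subset by blast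
    fix H K assume HK: "H \<in> ?A" "K \<in> ?A" "?f H = ?f K"
    have wf: "pair_wf_digraph H" using HK(1) subtree_wf by (auto simp: rooted_subtrees_def)
    have "\<exists>F. vertex_iso F H K \<and> F r = r"
      using same_code_vertex_iso[OF A[OF HK(1)] refl A[OF HK(2)] refl HK(3)] .
    then show "(H, K) \<in> ?R" using HK(1,2) rooted_iso_iff[OF wf, of r K r] by simp
  qed
  also have "\<dots> \<le> card (rsub (code V r))" using img by (intro card_mono) auto
  finally have "real (nr T r) \<le> real (card (rsub (code V r)))" by (simp add: nr_def)
  also have "\<dots> \<le> rho ^ card V"
    using card_rsub_within_bound[of "code V r"] by (simp add: within_bound_def rsize_code)
  finally show ?thesis .
qed

theorem ns_le:
  assumes T: "undirected_tree T"
  shows "real (ns T) \<le> 4 * rho ^ card (pverts T)"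
proof -
  obtain r where r: "r \<in> pverts T"
    using T connected_pair_graph[of T] by (auto simp: undirected_tree_def)
  obtain par dep where P: "parent_structure T r par dep" using undirected_tree_parents[OF T r] by blast
  interpret layered_tree T r par dep using T P by unfold_locales
  let ?A = "subtrees T"
  let ?R = "{(H, K). H \<in> ?A \<and> K \<in> ?A \<and> digraph_iso (with_proj H) (with_proj K)}"
  define top where "top H = (SOME v. parent_structure H v par dep \<and> (r \<in> pverts H \<longrightarrow> v = r))" for H
  let ?f = "\<lambda>H. code (pverts H) (top H)"
  have A: "parent_structure H (top H) par dep" "r \<in> pverts H \<Longrightarrow> top H = r" "pverts H \<subseteq> V" "top H \<in> V" if "H \<in> ?A" for H
  proof -
    have "\<exists>v. parent_structure H v par dep \<and> (r \<in> pverts H \<longrightarrow> v = r)"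
      using subtree_parents[OF T P that] by metis
    then have "parent_structure H (top H) par dep \<and> (r \<in> pverts H \<longrightarrow> top H = r)"
      unfolding top_def by (rule someI_ex)
    then show "parent_structure H (top H) par dep" "r \<in> pverts H \<Longrightarrow> top H = r" by auto
    show "pverts H \<subseteq> V" using that by (auto simp: subtrees_def subgraph_def)
    then show "top H \<in> V" using parent_structureD(1)[OF \<open>parent_structure H (top H) par dep\<close>] by blast
  qed
  have img: "?f ` ?A \<subseteq> allsub (code V r)"
  proof (rule image_subsetI)
    fix H assume H: "H \<in> ?A"
    have "?f H \<in> rsub (code V (top H))" by (rule code_in_rsub[OF A(3,4)[OF H]])
    then show "?f H \<in> allsub (code V r)"
      using rsub_subset_allsub allsub_code_mono[OF A(4)[OF H]] by (meson subsetD)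
  qed
  have fin: "finite (allsub (code V r))" using card_allsub_le by blast
  have "card (?A // ?R) \<le> card (?f ` ?A)"
  proof (rule card_quotient_le[OF equiv_subtree_iso])
    show "finite (?f ` ?A)" using img fin finite_subset by blast
    fix H K assume HK: "H \<in> ?A" "K \<in> ?A" "?f H = ?f K"
    then have "\<exists>F. vertex_iso F H K"
      using same_code_vertex_iso[OF A(1,3,2)[OF HK(1)] A(1,3,2)[OF HK(2)]] by blast
    then show "(H, K) \<in> ?R" using HK(1,2) digraph_iso_iff[OF subtree_wf[OF HK(1)], of K] by simp
  qed
  also have "\<dots> \<le> card (allsub (code V r))" using img fin by (intro card_mono) auto
  finally have "real (ns T) \<le> real (card (allsub (code V r)))" by (simp add: ns_def)
  also have "\<dots> \<le> 4 * (rho ^ card V - 1)"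
    using card_allsub_le[of "code V r"] by (simp add: rsize_code)
  finally show ?thesis by simp
qed

section \<open>Trees given by a parent function on natural numbers\<close>
definition parent_graph :: "(nat \<Rightarrow> nat) \<Rightarrow> nat set \<Rightarrow> nat pair_pre_digraph" where
  "parent_graph p S = \<lparr>pverts = S, parcs = (\<Union>v\<in>S - {0}. {(v, p v), (p v, v)})\<rparr>"

lemma parent_graph_simps [simp]:
  "pverts (parent_graph p S) = S"
  "parcs (parent_graph p S) = (\<Union>v\<in>S - {0}. {(v, p v), (p v, v)})"
  by (auto simp: parent_graph_def)

text \<open>
  As parents are smaller than their children, such a parent function always leads down to the root 0.
\<close>
definition parent_closed :: "(nat \<Rightarrow> nat) \<Rightarrow> nat set \<Rightarrow> bool" where
  "parent_closed p S \<longleftrightarrow> finite S \<and> 0 \<in> S \<and> (\<forall>v\<in>S. v \<noteq> 0 \<longrightarrow> p v \<in> S \<and> p v < v)"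

lemma parent_graph_pair_graph:
  assumes "parent_closed p S"
  shows "pair_graph (parent_graph p S)"
proof
  fix e assume e: "e \<in> parcs (parent_graph p S)"
  then obtain v where v: "v \<in> S" "v \<noteq> 0" "e = (v, p v) \<or> e = (p v, v)" by auto
  then have "p v \<in> S" "p v < v" using assms by (auto simp: parent_closed_def)
  then show "fst e \<in> pverts (parent_graph p S)" "snd e \<in> pverts (parent_graph p S)" "fst e \<noteq> snd e"
    using v by auto
next
  show "finite (pverts (parent_graph p S))" "finite (parcs (parent_graph p S))"
    using assms by (auto simp: parent_closed_def)
  show "symmetric (with_proj (parent_graph p S))"
    unfolding symmetric_def by (auto simp: sym_def)
qed

lemma parent_graph_connected:
  assumes "parent_closed p S"
  shows "Digraph_Component.connected (with_proj (parent_graph p S))"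
proof -
  let ?E = "parcs (parent_graph p S)"
  have reach: "(v, 0) \<in> ?E\<^sup>*" if "v \<in> S" for v
    using that
  proof (induction v rule: less_induct)
    case (less v)
    show ?case
    proof (cases "v = 0")
      case False
      then have "p v \<in> S" "p v < v" using assms less.prems by (auto simp: parent_closed_def)
      moreover have "(v, p v) \<in> ?E" using False less.prems by auto
      ultimately show ?thesis using less.IH by (meson converse_rtrancl_into_rtrancl)
    qed simp
  qed
  have "sym ?E" by (auto simp: sym_def)
  then have "(u, v) \<in> ?E\<^sup>*" if "u \<in> S" "v \<in> S" for u v
    using reach that by (meson rtrancl_trans sym_rtrancl symD)
  moreover have "S \<noteq> {}" using assms by (auto simp: parent_closed_def)
  ultimately show ?thesis
    using connected_pair_graph[OF parent_graph_pair_graph[OF assms]] by simp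
qed

text \<open>
  Both neighbours of the largest vertex on a cycle are smaller, hence both are its parent. On a cycle of
  length at least three they are distinct.
\<close>
lemma parent_graph_acyclic:
  assumes S: "parent_closed p S"
      and cyc: "pre_digraph.cycle (with_proj (parent_graph p S)) c"
  shows "length c < 3"
proof (rule ccontr)
  assume L: "\<not> length c < 3"
  let ?G = "parent_graph p S"
  interpret pair_graph ?G using S by (rule parent_graph_pair_graph)
  define L where "L = length c"
  define y where "y i = snd (c ! i)" for i
  obtain u where u: "awalk u c u" "distinct (tl (pawalk_verts u c))" and ne: "c \<noteq> []"
    using cyc by (auto simp: cycle_def)
  have cas: "pcas u c u" and E: "set c \<subseteq> parcs ?G" using u(1) by (auto simp: awalk_def)
  have verts: "pawalk_verts u c = u # map snd c" "pawalk_verts u c = map fst c @ [u]"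
  proof -
    have "fst (hd c) = u" using cas ne by (cases c) auto
    then show "pawalk_verts u c = u # map snd c" using awalk_verts_conv'[OF cas] ne by simp
    then have "last (u # map snd c) = last (map fst c @ [snd (last c)])"
      using awalk_verts_conv[of u c] ne by simp
    moreover have "awlast u c = u" using u(1) by simp
    ultimately show "pawalk_verts u c = map fst c @ [u]"
      using awalk_verts_conv[of u c] ne by simp
  qed
  have dist: "distinct (map snd c)" using u(2) verts(1) by simp
  have L3: "3 \<le> L" using L by (simp add: L_def)
  have fst_Suc: "fst (c ! (Suc i mod L)) = y i" if "i < L" for i
  proof (cases "Suc i = L")
    case True
    have "(map fst c @ [u]) ! 0 = u" using verts by (metis nth_Cons_0)
    then have "fst (c ! 0) = u" using ne by (simp add: nth_append)
    moreover have "(u # map snd c) ! Suc i = y i" using that by (simp add: L_def y_def)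
    moreover have "(map fst c @ [u]) ! length c = u" by (simp add: nth_append)
    moreover have "Suc i = length c" using True by (simp only: L_def)
    ultimately have "y i = u" "fst (c ! 0) = u" using verts by metis+
    then show ?thesis using True by simp
  next
    case False
    have "(map fst c @ [u]) ! Suc i = (u # map snd c) ! Suc i" using verts by simp
    then show ?thesis using False that by (simp add: nth_append L_def y_def)
  qed
  have adj: "y i \<in> S \<and> y (Suc i mod L) \<in> S \<and>
      (y (Suc i mod L) = p (y i) \<and> y i \<noteq> 0 \<or> y i = p (y (Suc i mod L)) \<and> y (Suc i mod L) \<noteq> 0)" if "i < L" for i
  proof -
    have "Suc i mod L < L" using that by simp
    then have "c ! (Suc i mod L) \<in> parcs ?G" using E unfolding L_def by (meson nth_mem subsetD)
    then have "(y i, y (Suc i mod L)) \<in> parcs ?G"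
      using fst_Suc[OF that] by (metis prod.collapse y_def)
    then show ?thesis using S by (auto simp: parent_closed_def)
  qed
  have "y 0 \<in> y ` {..<L}" using L3 by auto
  then have "finite (y ` {..<L})" "y ` {..<L} \<noteq> {}" by auto
  then have "Max (y ` {..<L}) \<in> y ` {..<L}" by (rule Max_in)
  then obtain i where i: "i < L" "y i = Max (y ` {..<L})" by (elim imageE) simp
  have max: "y j \<le> y i" if "j < L" for j unfolding i(2) using that by (intro Max_ge) auto
  \<comment> \<open>the cyclic predecessor of \<^term>\<open>i\<close>\<close>
  define h where "h = (i + L - 1) mod L"
  have h: "h < L" "Suc h mod L = i"
  proof -
    show "h < L" using L3 by (simp add: h_def)
    have "Suc h mod L = (i + L) mod L" unfolding h_def using L3 by (simp add: mod_Suc_eq)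
    then show "Suc h mod L = i" using i by simp
  qed
  have down: "p v < v" if "v \<in> S" "v \<noteq> 0" for v using S that by (auto simp: parent_closed_def)
  have "y (Suc i mod L) = p (y i)"
    using adj[OF i(1)] max[of "Suc i mod L"] down L3 by (metis i(1) leD mod_less_divisor not_gr0 not_less_zero)
  moreover have "y h = p (y i)"
    using adj[OF h(1)] max[OF h(1)] down unfolding h(2) by (metis leD)
  ultimately have "y (Suc i mod L) = y h" by simp
  moreover have "Suc i mod L < L" using L3 by simp
  ultimately have "Suc i mod L = h"
    using dist h(1) by (auto simp: y_def L_def distinct_conv_nth)
  then have "Suc (Suc i mod L) mod L = i" using h by simp
  then have "(i + 2) mod L = i" by (simp add: mod_Suc_eq)
  moreover have "(i + 2) mod L = (if i + 2 < L then i + 2 else i + 2 - L)"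
    using i(1) L3 by (simp add: le_mod_geq)
  ultimately show False using i(1) L3 by (auto split: if_splits)
qed

lemma parent_graph_undirected_tree:
  "parent_closed p S \<Longrightarrow> undirected_tree (parent_graph p S)"
  using parent_graph_pair_graph parent_graph_connected parent_graph_acyclic
  unfolding undirected_tree_def by (metis not_le)

lemma parent_graph_subtree:
  assumes "parent_closed p S" "parent_closed p W" "S \<subseteq> W"
  shows "parent_graph p S \<in> subtrees (parent_graph p W)"
proof -
  interpret G: pair_graph "parent_graph p S" using assms(1) by (rule parent_graph_pair_graph)
  interpret H: pair_graph "parent_graph p W" using assms(2) by (rule parent_graph_pair_graph)
  have "subgraph (with_proj (parent_graph p S)) (with_proj (parent_graph p W))"
    using assms(3) by (intro subgraphI) (auto intro!: G.wf_digraph H.wf_digraph)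
  then show ?thesis
    using parent_graph_connected[OF assms(1)] G.pair_graph_axioms by (simp add: subtrees_def)
qed

section \<open>A tree with many nonisomorphic subtrees\<close>

text \<open>
  The vertices $0, \dots, k+3$ form the spine. For $1 \le i \le k$ the spine vertex $i$ has two further
  children $k+3+i$ and $2k+3+i$, and the latter has the child $3k+3+i$. All other vertices are leaves
  attached to the root 0. The spine is long enough for its end to be the only vertex at distance $k+3$
  from the root.
\<close>
definition caterpillar_parent :: "nat \<Rightarrow> nat \<Rightarrow> nat" where
  "caterpillar_parent k v = (if v \<le> k + 3 then v - 1 else if v \<le> 2 * k + 3 then v - (k + 3)
     else if v \<le> 3 * k + 3 then v - (2 * k + 3) else if v \<le> 4 * k + 3 then v - k else 0)"

text \<open>
  The distance from the root.
\<close>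
definition caterpillar_level :: "nat \<Rightarrow> nat \<Rightarrow> nat" where
  "caterpillar_level k v = (if v \<le> k + 3 then v else if v \<le> 2 * k + 3 then v - (k + 3) + 1
     else if v \<le> 3 * k + 3 then v - (2 * k + 3) + 1 else if v \<le> 4 * k + 3 then v - (3 * k + 3) + 2 else 1)"

lemma caterpillar_parent_less: "v \<noteq> 0 \<Longrightarrow> caterpillar_parent k v < v"
  by (auto simp: caterpillar_parent_def)

lemma caterpillar_level_parent: "v \<noteq> 0 \<Longrightarrow> caterpillar_level k v = Suc (caterpillar_level k (caterpillar_parent k v))"
  by (auto simp: caterpillar_level_def caterpillar_parent_def)

lemma caterpillar_level_max: "caterpillar_level k v = k + 3 \<Longrightarrow> v = k + 3"
  by (auto simp: caterpillar_level_def split: if_splits)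

text \<open>
  The subtrees to be counted: they contain the spine and the leaves at the root. Of the two children of a
  spine vertex the leaf is only used together with the other one, as the two alternatives with
  exactly one of them are isomorphic. This leaves 5 possibilities for each \<^term>\<open>i\<close>.
\<close>
definition admissible :: "nat \<Rightarrow> nat \<Rightarrow> nat set \<Rightarrow> bool" where
  "admissible k n S \<longleftrightarrow> S \<subseteq> {..<n} \<and> {..k + 3} \<subseteq> S \<and> {4 * k + 4..<n} \<subseteq> S \<and>
     (\<forall>i\<in>{1..k}. (k + 3 + i \<in> S \<longrightarrow> 2 * k + 3 + i \<in> S) \<and> (3 * k + 3 + i \<in> S \<longrightarrow> 2 * k + 3 + i \<in> S))"

lemma admissible_parent_closed:
  assumes "admissible k n S"
  shows "parent_closed (caterpillar_parent k) S"
proof -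
  have "caterpillar_parent k v \<in> S" if v: "v \<in> S" "v \<noteq> 0" for v
  proof -
    have spine: "w \<in> S" if "w \<le> k + 3" for w using assms that by (auto simp: admissible_def)
    have "caterpillar_parent k v \<le> k + 3 \<or> 3 * k + 3 < v \<and> v \<le> 4 * k + 3" by (auto simp: caterpillar_parent_def)
    then consider "caterpillar_parent k v \<le> k + 3" | "3 * k + 3 < v" "v \<le> 4 * k + 3" by blast
    then show ?thesis
    proof cases
      case 2
      define i where "i = v - (3 * k + 3)"
      have "i \<in> {1..k}" "v = 3 * k + 3 + i" "caterpillar_parent k v = 2 * k + 3 + i"
        using 2 by (auto simp: i_def caterpillar_parent_def)
      then show ?thesis using assms v by (auto simp: admissible_def)
    qed (rule spine)
  qed
  then show ?thesis using assms caterpillar_parent_less finite_subset[of S "{..<n}"]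
    by (auto simp: parent_closed_def admissible_def)
qed

text \<open>
  An injective homomorphism \<^term>\<open>F\<close> fixes the root, the only vertex with more than five neighbours. Along
  the spine it cannot turn back, so it goes down one level at each step, and it must end in
  the only vertex on level $k+3$; so it fixes the spine. Hence it maps the parts attached to each
  spine vertex to parts attached to the same vertex, and whatever is present in \<^term>\<open>S\<close> is present in \<^term>\<open>S'\<close>.
\<close>
lemma admissible_subset_of_hom:
  assumes n: "4 * k + 9 \<le> n" and S: "admissible k n S" and S': "admissible k n S'"
      and inj: "inj_on F S"
      and hom: "\<And>x y. (x, y) \<in> parcs (parent_graph (caterpillar_parent k) S) \<Longrightarrow> (F x, F y) \<in> parcs (parent_graph (caterpillar_parent k) S')"
  shows "S \<subseteq> S'"
proof -
  let ?p = "caterpillar_parent k"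
  have spine: "w \<in> S" "w \<in> S'" if "w \<le> k + 3" for w using S S' that by (auto simp: admissible_def)
  have pads: "w \<in> S" "w \<in> S'" if "4 * k + 4 \<le> w" "w < n" for w using S S' that by (auto simp: admissible_def)
  have nbr: "F x \<in> S' \<and> F y \<in> S' \<and> (F y = ?p (F x) \<and> F x \<noteq> 0 \<or> F x = ?p (F y) \<and> F y \<noteq> 0)"
    if "x \<in> S" "y \<in> S" "x = ?p y \<and> y \<noteq> 0" for x y
  proof -
    have "(x, y) \<in> parcs (parent_graph ?p S)" using that by auto
    then show ?thesis using hom[of x y] admissible_parent_closed[OF S']
      by (auto simp: parent_closed_def)
  qed
  have F0: "F 0 = 0"
  proof (rule ccontr)
    assume nz: "F 0 \<noteq> 0"
    \<comment> \<open>A vertex other than 0 has at most five neighbours: its parent and four possible children.\<close>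
    define w where "w = F 0"
    let ?N = "insert 1 {4 * k + 4..<n}"
    have "F ` ?N \<subseteq> {?p w, w + 1, w + (k + 3), w + (2 * k + 3), w + k}"
    proof
      fix z assume "z \<in> F ` ?N"
      then obtain x where x: "x \<in> ?N" "z = F x" by (elim imageE)
      then have "x \<in> S" "?p x = 0 \<and> x \<noteq> 0" using spine(1)[of 1] pads(1)[of x] by (auto simp: caterpillar_parent_def)
      then have "z = ?p w \<or> w = ?p z \<and> z \<noteq> 0" using nbr[of 0 x] spine(1)[of 0] x by (auto simp: w_def)
      moreover have "z = w + 1 \<or> z = w + (k + 3) \<or> z = w + (2 * k + 3) \<or> z = w + k" if "w = ?p z" "z \<noteq> 0"
        using that nz by (auto simp: caterpillar_parent_def w_def split: if_splits)
      ultimately show "z \<in> {?p w, w + 1, w + (k + 3), w + (2 * k + 3), w + k}" by auto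
    qed
    then have "card (F ` ?N) \<le> card {?p w, w + 1, w + (k + 3), w + (2 * k + 3), w + k}"
      by (intro card_mono) auto
    also have "\<dots> \<le> 5" by (intro card_insert_le_m1) auto
    finally have "card (F ` ?N) \<le> 5" .
    moreover have "card (F ` ?N) = card ?N"
      using spine(1)[of 1] pads(1) by (intro card_image inj_on_subset[OF inj]) auto
    moreover have "card ?N = Suc (n - (4 * k + 4))" by simp
    ultimately show False using n by simp
  qed
  have p_spine: "?p (Suc j) = j" if "j < k + 3" for j using that by (simp add: caterpillar_parent_def)
  have up: "?p (F (Suc j)) = F j \<and> F (Suc j) \<noteq> 0" if "j < k + 3" for j
    using that
  proof (induction j)
    case 0
    then show ?case using nbr[of 0 1] spine(1)[of 0] spine(1)[of 1] F0 p_spine[of 0] by auto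
  next
    case (Suc j)
    have "F (Suc (Suc j)) \<noteq> F j"
      using inj_onD[OF inj, of "Suc (Suc j)" j] spine(1)[of "Suc (Suc j)"] spine(1)[of j] Suc.prems by auto
    then show ?case
      using Suc nbr[of "Suc j" "Suc (Suc j)"] spine(1)[of "Suc j"] spine(1)[of "Suc (Suc j)"] p_spine[of "Suc j"]
      by auto
  qed
  have lev: "caterpillar_level k (F j) = j" if "j \<le> k + 3" for j
    using that
  proof (induction j)
    case 0
    then show ?case using F0 by (simp add: caterpillar_level_def)
  next
    case (Suc j)
    then show ?case using up[of j] caterpillar_level_parent[of "F (Suc j)" k] by auto
  qed
  have fix_spine: "F (k + 3 - d) = k + 3 - d" for d
  proof (induction d)
    case 0
    then show ?case using lev[of "k + 3"] caterpillar_level_max by simp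
  next
    case (Suc d)
    show ?case
    proof (cases "d < k + 3")
      case True
      define j where "j = k + 3 - Suc d"
      have j: "j < k + 3" "Suc j = k + 3 - d" using True by (auto simp: j_def)
      then have "F (Suc j) = Suc j" using Suc by simp
      then show ?thesis using up[of j] p_spine[of j] j by (simp add: j_def[symmetric])
    next
      case False
      then show ?thesis using Suc by simp
    qed
  qed
  have F_spine: "F j = j" if "j \<le> k + 3" for j
    using fix_spine[of "k + 3 - j"] that by simp
  have pair: "F x \<in> {k + 3 + i, 2 * k + 3 + i} \<and> F x \<in> S'"
    if i: "i \<in> {1..k}" and x: "x \<in> {k + 3 + i, 2 * k + 3 + i}" "x \<in> S" for i x
  proof -
    have px: "i = ?p x \<and> x \<noteq> 0" using i x(1) by (auto simp: caterpillar_parent_def)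
    have iS: "i \<in> S" and Fi: "F i = i" using i spine(1)[of i] F_spine[of i] by auto
    have N: "F x \<in> S'" "F x = ?p i \<or> i = ?p (F x) \<and> F x \<noteq> 0"
      using nbr[OF iS x(2) px] unfolding Fi by blast+
    have "\<not> x \<le> k + 3" using i x(1) by auto
    then have ne: "F x \<noteq> j" if "j \<le> k + 3" for j
      using inj_onD[OF inj _ x(2) spine(1)[OF that]] F_spine[OF that] that by metis
    have "?p i = i - 1" using i by (auto simp: caterpillar_parent_def)
    moreover have "F x \<noteq> i - 1" by (rule ne) (use i in auto)
    ultimately have "i = ?p (F x)" using N(2) by metis
    moreover have "\<not> F x \<le> k + 3" using ne by blast
    ultimately have "i = ?p (F x)" "\<not> F x \<le> k + 3" by blast+
    then show ?thesis using N(1) i by (auto simp: caterpillar_parent_def split: if_splits)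
  qed
  have a: "2 * k + 3 + i \<in> S'" if "i \<in> {1..k}" "2 * k + 3 + i \<in> S" for i
    using pair[of i "2 * k + 3 + i"] that S' by (auto simp: admissible_def)
  have b: "k + 3 + i \<in> S'" if i: "i \<in> {1..k}" and x: "k + 3 + i \<in> S" for i
  proof -
    have y: "2 * k + 3 + i \<in> S" using S i x by (auto simp: admissible_def)
    have "F (k + 3 + i) \<noteq> F (2 * k + 3 + i)" using inj_onD[OF inj _ x y] i by auto
    then show ?thesis using pair[OF i _ x] pair[OF i _ y] by auto
  qed
  have c: "3 * k + 3 + i \<in> S'" if i: "i \<in> {1..k}" and x: "3 * k + 3 + i \<in> S" for i
  proof -
    have y: "2 * k + 3 + i \<in> S" using S i x by (auto simp: admissible_def)
    have "?p (3 * k + 3 + i) = 2 * k + 3 + i" using i by (simp add: caterpillar_parent_def)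
    then have N: "F (3 * k + 3 + i) \<in> S'" "F (3 * k + 3 + i) = ?p (F (2 * k + 3 + i)) \<or>
        F (2 * k + 3 + i) = ?p (F (3 * k + 3 + i)) \<and> F (3 * k + 3 + i) \<noteq> 0"
      using nbr[OF y x] by auto
    have "F (3 * k + 3 + i) \<noteq> i"
      using inj_onD[OF inj, of "3 * k + 3 + i" i] F_spine[of i] spine(1)[of i] x i by auto
    moreover have "F (2 * k + 3 + i) = k + 3 + i \<or> F (2 * k + 3 + i) = 2 * k + 3 + i"
      using pair[OF i _ y] by auto
    ultimately have "F (3 * k + 3 + i) = 3 * k + 3 + i"
      using N(2) i by (auto simp: caterpillar_parent_def split: if_splits)
    then show ?thesis using N(1) by simp
  qed
  show "S \<subseteq> S'"
  proof
    fix x assume x: "x \<in> S"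
    then have "x < n" using S by (auto simp: admissible_def)
    then consider "x \<le> k + 3" | "4 * k + 4 \<le> x" | "k + 3 < x" "x \<le> 2 * k + 3"
      | "2 * k + 3 < x" "x \<le> 3 * k + 3" | "3 * k + 3 < x" "x \<le> 4 * k + 3" by linarith
    then show "x \<in> S'"
    proof cases
      case 3
      then have "x - (k + 3) \<in> {1..k}" "k + 3 + (x - (k + 3)) = x" by auto
      then show ?thesis using b[of "x - (k + 3)"] x by simp
    next
      case 4
      then have "x - (2 * k + 3) \<in> {1..k}" "2 * k + 3 + (x - (2 * k + 3)) = x" by auto
      then show ?thesis using a[of "x - (2 * k + 3)"] x by simp
    next
      case 5
      then have "x - (3 * k + 3) \<in> {1..k}" "3 * k + 3 + (x - (3 * k + 3)) = x" by auto
      then show ?thesis using c[of "x - (3 * k + 3)"] x by simp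
    qed (use spine pads \<open>x < n\<close> in auto)
  qed
qed

lemma admissible_eq_of_iso:
  assumes n: "4 * k + 9 \<le> n" and S: "admissible k n S" "admissible k n S'"
      and iso: "vertex_iso F (parent_graph (caterpillar_parent k) S) (parent_graph (caterpillar_parent k) S')"
  shows "S = S'"
proof -
  have sub: "X \<subseteq> Y" if "admissible k n X" "admissible k n Y" "vertex_iso G (parent_graph (caterpillar_parent k) X) (parent_graph (caterpillar_parent k) Y)" for X Y G
  proof (rule admissible_subset_of_hom[OF n that(1,2)])
    show "inj_on G X" using that(3) by (simp add: vertex_iso_def)
    show "(G x, G y) \<in> parcs (parent_graph (caterpillar_parent k) Y)" if "(x, y) \<in> parcs (parent_graph (caterpillar_parent k) X)" for x y
      using that \<open>vertex_iso G _ _\<close> unfolding vertex_iso_def by (metis image_eqI map_prod_simp)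
  qed
  have "pair_wf_digraph (parent_graph (caterpillar_parent k) S)"
    using parent_graph_pair_graph[OF admissible_parent_closed[OF S(1)]]
    by (auto simp: pair_graph_def pair_digraph_def pair_fin_digraph_def)
  then show ?thesis using sub[OF S iso] sub[OF S(2,1) vertex_iso_sym[OF _ iso]] by blast
qed

text \<open>
  The values 0, 1, 2, 3, 4 of \<^term>\<open>f i\<close> stand for the five possibilities at the spine vertex \<^term>\<open>i\<close>: the two
  children $2k+3+i$ and $k+3+i$ are present from the values 1 and 3 on, and the grandchild for the values
  2 and 4.
\<close>
definition chosen_vertices :: "nat \<Rightarrow> nat \<Rightarrow> (nat \<Rightarrow> nat) \<Rightarrow> nat set" where
  "chosen_vertices k n f = {..k + 3} \<union> {4 * k + 4..<n} \<union> {k + 3 + i | i. i \<in> {1..k} \<and> 3 \<le> f i} \<union>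
     {2 * k + 3 + i | i. i \<in> {1..k} \<and> 1 \<le> f i} \<union> {3 * k + 3 + i | i. i \<in> {1..k} \<and> f i \<in> {2, 4}}"

lemma chosen_vertices_iff:
  assumes "i \<in> {1..k}"
  shows "k + 3 + i \<in> chosen_vertices k n f \<longleftrightarrow> 3 \<le> f i"
    and "2 * k + 3 + i \<in> chosen_vertices k n f \<longleftrightarrow> 1 \<le> f i"
    and "3 * k + 3 + i \<in> chosen_vertices k n f \<longleftrightarrow> f i \<in> {2, 4}"
  using assms by (auto simp: chosen_vertices_def)

lemma chosen_vertices_admissible:
  assumes "4 * k + 9 \<le> n"
  shows "admissible k n (chosen_vertices k n f)"
  unfolding admissible_def
proof (intro conjI ballI)
  show "chosen_vertices k n f \<subseteq> {..<n}" using assms by (auto simp: chosen_vertices_def)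
  show "{..k + 3} \<subseteq> chosen_vertices k n f" "{4 * k + 4..<n} \<subseteq> chosen_vertices k n f" by (auto simp: chosen_vertices_def)
qed (auto simp: chosen_vertices_iff)

lemma chosen_vertices_inj: "inj_on (chosen_vertices k n) ({1..k} \<rightarrow>\<^sub>E {..<5})"
proof (rule inj_onI)
  fix f g assume fg: "f \<in> {1..k} \<rightarrow>\<^sub>E {..<5::nat}" "g \<in> {1..k} \<rightarrow>\<^sub>E {..<5::nat}" "chosen_vertices k n f = chosen_vertices k n g"
  have "f i = g i" if i: "i \<in> {1..k}" for i
  proof -
    have "f i < 5" "g i < 5" using fg i by (auto simp: PiE_iff)
    moreover have "3 \<le> f i \<longleftrightarrow> 3 \<le> g i" "1 \<le> f i \<longleftrightarrow> 1 \<le> g i" "f i \<in> {2, 4} \<longleftrightarrow> g i \<in> {2, 4}"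
      using chosen_vertices_iff[OF i, of n f] chosen_vertices_iff[OF i, of n g] fg(3) by auto
    ultimately show ?thesis by auto
  qed
  then show "f = g" by (rule PiE_ext[OF fg(1,2)])
qed

lemma finite_subtrees:
  assumes "pair_graph T"
  shows "finite (subtrees T)"
proof -
  interpret pair_graph T by fact
  have "subtrees T \<subseteq> (\<lambda>(a, b). \<lparr>pverts = a, parcs = b\<rparr>) ` (Pow (pverts T) \<times> Pow (parcs T))"
  proof
    fix H assume "H \<in> subtrees T"
    then have "pverts H \<subseteq> pverts T" "parcs H \<subseteq> parcs T" by (auto simp: subtrees_def subgraph_def)
    then show "H \<in> (\<lambda>(a, b). \<lparr>pverts = a, parcs = b\<rparr>) ` (Pow (pverts T) \<times> Pow (parcs T))"
      by (intro image_eqI[of _ _ "(pverts H, parcs H)"]) auto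
  qed
  then show ?thesis using pair_finite_verts pair_finite_arcs by (auto intro: finite_subset)
qed

theorem many_subtrees:
  assumes n: "4 * k + 9 \<le> n"
  defines "T \<equiv> parent_graph (caterpillar_parent k) {..<n}"
  shows "undirected_tree T" "card (pverts T) = n" "0 \<in> pverts T" "5 ^ k \<le> ns T" "5 ^ k \<le> nr T 0"
proof -
  let ?B = "{1..k} \<rightarrow>\<^sub>E {..<5::nat}" and ?g = "\<lambda>f. parent_graph (caterpillar_parent k) (chosen_vertices k n f)"
  have "admissible k n {..<n}" using n by (auto simp: admissible_def)
  then have closed: "parent_closed (caterpillar_parent k) {..<n}" by (rule admissible_parent_closed)
  then show T: "undirected_tree T" unfolding T_def by (rule parent_graph_undirected_tree)
  show "card (pverts T) = n" "0 \<in> pverts T" using n by (auto simp: T_def)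
  have adm: "admissible k n (chosen_vertices k n f)" for f using n by (rule chosen_vertices_admissible)
  have sub: "?g f \<in> subtrees T" for f
    unfolding T_def using adm[of f] admissible_parent_closed[OF adm] closed
    by (intro parent_graph_subtree) (auto simp: admissible_def)
  have rsub: "?g f \<in> rooted_subtrees T 0" for f
    using sub adm[of f] by (auto simp: rooted_subtrees_def admissible_def)
  have eq: "f = f'" if "f \<in> ?B" "f' \<in> ?B" "vertex_iso F (?g f) (?g f')" for f f' F
    using admissible_eq_of_iso[OF n adm adm that(3)] chosen_vertices_inj that by (auto dest: inj_onD)
  have fin: "finite (subtrees T)" using T finite_subtrees by (auto simp: undirected_tree_def)
  then have fin': "finite (rooted_subtrees T 0)" by (simp add: rooted_subtrees_def)
  have cardB: "card ?B = 5 ^ k" by (simp add: card_PiE)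
  have "card ?B \<le> ns T" unfolding ns_def
  proof (rule card_quotient_ge[OF _ equiv_subtree_iso, where g = ?g])
    show "finite (subtrees T // {(H, K). H \<in> subtrees T \<and> K \<in> subtrees T \<and> digraph_iso (with_proj H) (with_proj K)})"
      using fin by (intro finite_quotient) auto
    show "?g ` ?B \<subseteq> subtrees T" using sub by blast
    fix f f' assume f: "f \<in> ?B" "f' \<in> ?B"
      and "(?g f, ?g f') \<in> {(H, K). H \<in> subtrees T \<and> K \<in> subtrees T \<and> digraph_iso (with_proj H) (with_proj K)}"
    then have "digraph_iso (with_proj (?g f)) (with_proj (?g f'))" by simp
    then obtain F where "vertex_iso F (?g f) (?g f')"
      unfolding digraph_iso_iff[OF subtree_wf[OF sub]] by (elim exE)
    then show "f = f'" by (rule eq[OF f])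
  qed
  then show "5 ^ k \<le> ns T" by (simp only: cardB)
  have "card ?B \<le> nr T 0" unfolding nr_def
  proof (rule card_quotient_ge[OF _ equiv_rooted_subtree_iso, where g = ?g])
    show "finite (rooted_subtrees T 0 // {(H, K). H \<in> rooted_subtrees T 0 \<and> K \<in> rooted_subtrees T 0 \<and> rooted_iso H 0 K 0})"
      using fin' by (intro finite_quotient) auto
    show "?g ` ?B \<subseteq> rooted_subtrees T 0" using rsub by blast
    fix f f' assume f: "f \<in> ?B" "f' \<in> ?B"
      and "(?g f, ?g f') \<in> {(H, K). H \<in> rooted_subtrees T 0 \<and> K \<in> rooted_subtrees T 0 \<and> rooted_iso H 0 K 0}"
    then have "rooted_iso (?g f) 0 (?g f') 0" by simp
    then obtain F where "vertex_iso F (?g f) (?g f')"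
      unfolding rooted_iso_iff[OF subtree_wf[OF sub]] by (elim exE conjE)
    then show "f = f'" by (rule eq[OF f])
  qed
  then show "5 ^ k \<le> nr T 0" by (simp only: cardB)
qed

section \<open>The asymptotic statement\<close>
lemma Max_nat_bounds:
  fixes X :: "nat set"
  assumes "\<And>x. x \<in> X \<Longrightarrow> real x \<le> u" "y \<in> X" "l \<le> real y"
  shows "l \<le> real (Max X)" "real (Max X) \<le> u"
proof -
  have "x \<le> nat \<lfloor>u\<rfloor>" if "x \<in> X" for x using assms(1)[OF that] by (simp add: le_nat_floor)
  then have fin: "finite X" by (meson atMost_iff finite_atMost finite_subset subsetI)
  then have "y \<le> Max X" using assms(2) by simp
  then show "l \<le> real (Max X)" using assms(3) by simp
  have "Max X \<in> X" using fin assms(2) by (intro Max_in) auto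
  then show "real (Max X) \<le> u" by (rule assms(1))
qed

lemma max_bounds:
  assumes n: "9 \<le> n"
  shows "rho ^ n / 125 \<le> real (S_max n)" "real (S_max n) \<le> 4 * rho ^ n"
    and "rho ^ n / 125 \<le> real (R_max n)" "real (R_max n) \<le> 4 * rho ^ n"
proof -
  define k where "k = (n - 9) div 4"
  have k: "4 * k + 9 \<le> n" "n \<le> 4 * k + 12" using n by (auto simp: k_def)
  define T where "T = parent_graph (caterpillar_parent k) {..<n}"
  note lower = many_subtrees[OF k(1), folded T_def]
  \<comment> \<open>At most 12 of the \<^term>\<open>n\<close> vertices are lost, which costs the factor \<^term>\<open>rho ^ 12 = 125\<close>.\<close>
  have "rho ^ n \<le> rho ^ (4 * (k + 3))" using k by (intro rho_pow_mono) simp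
  also have "\<dots> = 125 * 5 ^ k" by (simp only: power_mult rho_pow4) (simp add: power_add)
  finally have large: "rho ^ n / 125 \<le> real (5 ^ k)" by simp
  let ?S = "{ns T | T :: nat pair_pre_digraph. undirected_tree T \<and> card (pverts T) = n}"
  have S: "real x \<le> 4 * rho ^ n" if "x \<in> ?S" for x using that ns_le by auto
  have "ns T \<in> ?S" using lower by auto
  moreover have "rho ^ n / 125 \<le> real (ns T)" using large lower(4) by (meson of_nat_le_iff order.trans)
  ultimately show "rho ^ n / 125 \<le> real (S_max n)" "real (S_max n) \<le> 4 * rho ^ n"
    unfolding S_max_def using Max_nat_bounds[of ?S, OF S] by blast+
  let ?R = "{nr T r | (T :: nat pair_pre_digraph) r. undirected_tree T \<and> r \<in> pverts T \<and> card (pverts T) = n}"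
  have R: "real x \<le> 4 * rho ^ n" if x: "x \<in> ?R" for x
  proof -
    have "real x \<le> rho ^ n" using x nr_le by auto
    also have "\<dots> \<le> 4 * rho ^ n" using rho_pow_pos[of n] by simp
    finally show ?thesis .
  qed
  have "nr T 0 \<in> ?R" using lower by auto
  moreover have "rho ^ n / 125 \<le> real (nr T 0)" using large lower(5) by (meson of_nat_le_iff order.trans)
  ultimately show "rho ^ n / 125 \<le> real (R_max n)" "real (R_max n) \<le> 4 * rho ^ n"
    unfolding R_max_def using Max_nat_bounds[of ?R, OF R] by blast+
qed

lemma rho_power: "rho ^ n = 5 powr (real n / 4)"
  by (simp add: rho_def powr_power)

lemma bigtheta_rho:
  assumes "\<And>n. 9 \<le> n \<Longrightarrow> rho ^ n / 125 \<le> real (f n) \<and> real (f n) \<le> 4 * rho ^ n"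
  shows "(\<lambda>n. real (f n)) \<in> \<Theta>(\<lambda>n. 5 powr (real n / 4))"
proof (rule bigthetaI')
  show "\<forall>\<^sub>F n in sequentially. 1 / 125 * norm (5 powr (real n / 4)) \<le> norm (real (f n)) \<and>
      norm (real (f n)) \<le> 4 * norm (5 powr (real n / 4))"
    using eventually_ge_at_top[of 9]
  proof eventually_elim
    case (elim n)
    then show ?case using assms[OF elim] by (simp flip: rho_power add: less_imp_le)
  qed
qed auto

theorem theorem4:
  shows "(\<lambda>n. real (S_max n)) \<in> \<Theta>(\<lambda>n. 5 powr (real n / 4)) \<and>
         (\<lambda>n. real (R_max n)) \<in> \<Theta>(\<lambda>n. 5 powr (real n / 4))"
  using max_bounds by (intro conjI bigtheta_rho) blast+

end
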